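(* Let $\alpha_1>-1$ and $\alpha>-1$ be fixed. For the Laguerre $\beta$-ensemble with $\beta=2\alpha/N$, let $m^{\rm L}_{p,0}$ be the limiting moments and $\mu^{\rm L}_{(p,q),0}$ the limiting scaled covariances of monomial linear statistics (see context; the large-$N$ expansion stated there is assumed). Then for all integers $p\ge0$ and $q\ge1$, $$\mu_{(p+1,q),0}^{\rm L}=(p+1+\alpha_1)\,\mu_{(p,q),0}^{\rm L}+q\,m_{p+q,0}^{\rm L}+2\alpha\sum_{s=0}^{p-1}m_{s,0}^{\rm L}\,\mu_{(p-s,q),0}^{\rm L}$$ $$\qquad=(p+1+\alpha_1+2\alpha)\,\mu_{(p,q),0}^{\rm L}+q\,m_{p+q,0}^{\rm L}+2\alpha\sum_{s=1}^{p-1}m_{s,0}^{\rm L}\,\mu_{(p-s,q),0}^{\rm L},$$ where $\mu^{\rm L}_{(0,q),0}=0$ and empty sums are zero.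
   Context: The Laguerre $\beta$-ensemble is the probability density on $(0,\infty)^N$ proportional to $\prod_{l=1}^N\lambda_l^{\alpha_1}e^{-\lambda_l}\prod_{1\le j<k\le N}|\lambda_k-\lambda_j|^\beta$. Here $\beta=2\alpha/N$ with $\alpha,\alpha_1$ fixed, and $N\to\infty$. For $n\ge1$ let $\overline W_n(x_1,\dots,x_n)$ be the joint cumulant (connected correlator) of the linear statistics $\sum_{j=1}^N\frac1{x_1-\lambda_j},\dots,\sum_{j=1}^N\frac1{x_n-\lambda_j}$; in particular $\overline W_1$ is the mean and $\overline W_2$ the covariance. Standing assumption (large-$N$ ansatz): with $\beta=2\alpha/N$, $\overline W_n(x_1,\dots,x_n)=N\sum_{l=0}^\infty N^{-l}\,W_n^{l}(x_1,\dots,x_n)$ for large $N$, with the $W_n^l$ independent of $N$. The limiting quantities are the coefficients in the expansions about infinity $W_1^{0}(x)=\frac1x\sum_{p\ge0}m^{\rm L}_{p,0}x^{-p}$ and $W_2^{0}(x_1,x_2)=\frac1{x_1x_2}\sum_{p,q\ge1}\mu^{\rm L}_{(p,q),0}x_1^{-p}x_2^{-q}$. Thus $m^{\rm L}_{p,0}=\lim_{N\to\infty}\frac1N\big\langle\sum_{j=1}^N\lambda_j^p\big\rangle$ are the moments of the limiting eigenvalue density ($m^{\rm L}_{0,0}=1$), and $\mu^{\rm L}_{(p,q),0}=\lim_{N\to\infty}\frac1N{\rm Cov}\big(\sum_{i=1}^N\lambda_i^p,\sum_{i=1}^N\lambda_i^q\big)$, all with $\beta=2\alpha/N$. *)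

theory Defs
  imports "HOL-Probability.Probability"
begin

text \<open>Points of \<open>\<real>\<^sup>N\<close> are functions \<open>nat \<Rightarrow> real\<close>, extensional on \<open>{..<N}\<close>; the reference
  measure is the \<open>N\<close>-fold product of Lebesgue measure.\<close>

definition laguerre_weight :: "real \<Rightarrow> real \<Rightarrow> nat \<Rightarrow> (nat \<Rightarrow> real) \<Rightarrow> real" where
  "laguerre_weight \<alpha>\<^sub>1 \<beta> N x =
     (if \<forall>l<N. 0 < x l
      then (\<Prod>l<N. x l powr \<alpha>\<^sub>1 * exp (- x l)) * (\<Prod>k<N. \<Prod>j<k. \<bar>x k - x j\<bar> powr \<beta>)
      else 0)"

definition laguerre_partition_function :: "real \<Rightarrow> real \<Rightarrow> nat \<Rightarrow> real" where
  "laguerre_partition_function \<alpha>\<^sub>1 \<beta> N =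
     (\<integral>x. laguerre_weight \<alpha>\<^sub>1 \<beta> N x \<partial>(\<Pi>\<^sub>M i\<in>{..<N}. lborel))"

text \<open>For parameters where the weight is not integrable (possible only for \<open>\<beta> < 0\<close> when
  \<open>\<alpha>\<^sub>1 > -1\<close>) no such probability density exists, and the measure below is the null measure.\<close>

definition laguerre_ensemble :: "real \<Rightarrow> real \<Rightarrow> nat \<Rightarrow> (nat \<Rightarrow> real) measure" where
  "laguerre_ensemble \<alpha>\<^sub>1 \<beta> N =
     density (\<Pi>\<^sub>M i\<in>{..<N}. lborel)
       (\<lambda>x. ennreal (laguerre_weight \<alpha>\<^sub>1 \<beta> N x / laguerre_partition_function \<alpha>\<^sub>1 \<beta> N))"

abbreviation high_temp_ensemble :: "real \<Rightarrow> real \<Rightarrow> nat \<Rightarrow> (nat \<Rightarrow> real) measure" where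
  "high_temp_ensemble \<alpha>\<^sub>1 \<alpha> N \<equiv> laguerre_ensemble \<alpha>\<^sub>1 (2 * \<alpha> / real N) N"

definition linear_statistic ::
    "nat \<Rightarrow> (real \<Rightarrow> 'b::comm_monoid_add) \<Rightarrow> (nat \<Rightarrow> real) \<Rightarrow> 'b" where
  "linear_statistic N f x = (\<Sum>j<N. f (x j))"

definition covariance :: "'a measure \<Rightarrow> ('a \<Rightarrow> real) \<Rightarrow> ('a \<Rightarrow> real) \<Rightarrow> real" where
  "covariance M X Y = (\<integral>\<omega>. (X \<omega> - (\<integral>\<eta>. X \<eta> \<partial>M)) * (Y \<omega> - (\<integral>\<eta>. Y \<eta> \<partial>M)) \<partial>M)"

definition joint_cumulant ::
    "'a measure \<Rightarrow> nat set \<Rightarrow> (nat \<Rightarrow> 'a \<Rightarrow> complex) \<Rightarrow> complex" where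
  "joint_cumulant M I X =
     (\<Sum>P | partition_on I P.
        (- 1) ^ (card P - 1) * fact (card P - 1) * (\<Prod>B\<in>P. \<integral>\<omega>. (\<Prod>i\<in>B. X i \<omega>) \<partial>M))"

text \<open>The connected correlator \<open>W\<^bsub>n\<^esub>(x\<^sub>1,\<dots>,x\<^sub>n)\<close>; the order \<open>n\<close> is the length of the
  list of arguments.\<close>

definition connected_correlator :: "real \<Rightarrow> real \<Rightarrow> nat \<Rightarrow> complex list \<Rightarrow> complex" where
  "connected_correlator \<alpha>\<^sub>1 \<alpha> N xs =
     joint_cumulant (high_temp_ensemble \<alpha>\<^sub>1 \<alpha> N) {..<length xs}
       (\<lambda>i. linear_statistic N (\<lambda>t. 1 / (xs ! i - of_real t)))"

text \<open>The expansion in \<open>1/N\<close> is read as an asymptotic expansion to all orders, pointwise for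
  arguments off the support \<open>[0,\<infinity>)\<close>; an expansion converging for all large \<open>N\<close> is one in
  particular.  The value \<open>W n l xs\<close> is only relevant when \<open>length xs = n\<close>.\<close>

definition large_N_ansatz ::
    "real \<Rightarrow> real \<Rightarrow> (nat \<Rightarrow> nat \<Rightarrow> complex list \<Rightarrow> complex) \<Rightarrow> bool" where
  "large_N_ansatz \<alpha>\<^sub>1 \<alpha> W \<longleftrightarrow>
     (\<forall>n\<ge>1. \<forall>xs. length xs = n \<and> set xs \<inter> \<real>\<^sub>\<ge>\<^sub>0 = {} \<longrightarrow>
        (\<forall>L. (\<lambda>N. connected_correlator \<alpha>\<^sub>1 \<alpha> N xs
                    - of_nat N * (\<Sum>l<L. W n l xs / of_nat N ^ l))
               \<in> O(\<lambda>N. of_nat N * (1 / of_nat N ^ L))))"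

text \<open>The moments may grow factorially (for \<open>\<alpha> = 0\<close> they are those of a gamma density), so
  expansions about infinity are asymptotic rather than convergent.  They are only required
  along the negative real axis, away from the cut \<open>[0,\<infinity>)\<close>, which already determines the
  coefficients.\<close>

definition expansion_at_infinity1 :: "(complex \<Rightarrow> complex) \<Rightarrow> (nat \<Rightarrow> real) \<Rightarrow> bool" where
  "expansion_at_infinity1 f m \<longleftrightarrow>
     (\<forall>K. (\<lambda>x::real. norm (f (of_real x)
                 - 1 / of_real x * (\<Sum>p<K. of_real (m p) / of_real x ^ p)))
            \<in> O[at_bot](\<lambda>x. 1 / \<bar>x\<bar> * (1 / \<bar>x\<bar> ^ K)))"

definition expansion_at_infinity2 ::
    "(complex \<Rightarrow> complex \<Rightarrow> complex) \<Rightarrow> (nat \<Rightarrow> nat \<Rightarrow> real) \<Rightarrow> bool" where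
  "expansion_at_infinity2 f \<mu> \<longleftrightarrow>
     (\<forall>K. (\<lambda>(x::real, y::real). norm (f (of_real x) (of_real y)
                 - 1 / (of_real x * of_real y) *
                   (\<Sum>p=1..<K. \<Sum>q=1..<K. of_real (\<mu> p q) / (of_real x ^ p * of_real y ^ q))))
            \<in> O[at_bot \<times>\<^sub>F at_bot](\<lambda>(x, y). 1 / (\<bar>x\<bar> * \<bar>y\<bar>) * (1 / \<bar>x\<bar> ^ K + 1 / \<bar>y\<bar> ^ K)))"

end

theory Submission
  imports Defs
begin

text \<open>The covariances obey the recursion up to terms \<open>\<alpha> N\<^sup>-\<^sup>2\<close> times a third cumulant, by the loop
  equation of the vector field \<open>x\<^sub>j\<^sup>p\<^sup>+\<^sup>1\<close> tested against a power sum. The loop equation is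
  obtained by differentiating at \<open>\<epsilon> = 0\<^sup>+\<close> the invariance of the integral under the bijection
  \<open>x \<mapsto> x + \<epsilon> x\<^sup>p\<^sup>+\<^sup>1\<close> of \<open>(0,\<infinity>)\<close>, applied to every coordinate: the ratio of the transformed
  Vandermonde factor to the original one is smooth, so there are neither boundary terms nor
  singularities on the diagonals, also when \<open>\<beta> < 0\<close>.

  Third cumulants are negligible for the following reason. Tested against products
  of centered power sums, the loop equations express every centered moment by moments of total
  degree one less; since the covariances of the normalised power sums are \<open>O(1/N)\<close>, induction on the
  degree shows that all centered moments with at least three factors are \<open>O(N\<^sup>-\<^sup>2)\<close>.\<close>

section \<open>Monotone changes of variables on the positive orthant\<close>

text \<open>The factor \<open>2 * \<alpha>\<close> has two sources. With \<beta> = 2\<alpha>/N, the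
  Vandermonde factor contributes \<beta>/2 = \<alpha>/N times a quadratic expression in power sums,
  which is \<alpha> after normalisation. A covariance with the product of the power sums of
  exponents s and r - s then yields one term for each factor, and the reflection s -> r - s
  identifies the two resulting sums. Induction on the number of factors cannot close the hierarchy,
  because the quadratic expression adds a factor. Centering by the exact means at each N is
  essential: subtracting the loop equation without test factors cancels the products of two means,
  which are of order one. The only nonlinear remainder is a product of two centered moments, each
  O(1/N) when three or more factors were present at the start. For \<beta> < 0 the weight may fail
  to be integrable, and the ensemble is then the null measure. The identities at fixed N therefore
  rest on a nonzero partition function alone, and the case of infinitely many degenerate N is
  settled separately in the limit.\<close>

locale half_line_map =
  fixes \<phi> \<phi>' :: "real \<Rightarrow> real"
  assumes deriv: "\<And>x. 0 \<le> x \<Longrightarrow> (\<phi> has_real_derivative \<phi>' x) (at x)"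
    and cont_deriv: "continuous_on {0..} \<phi>'"
    and deriv_nonneg: "\<And>x. 0 \<le> x \<Longrightarrow> 0 \<le> \<phi>' x"
    and zero: "\<phi> 0 = 0"
    and unbounded: "filterlim \<phi> at_top at_top"
    and meas[measurable]: "\<phi> \<in> borel_measurable borel" "\<phi>' \<in> borel_measurable borel"
begin

lemma mono_on_half_line: "mono_on {0..} \<phi>"
proof (rule mono_onI)
  fix x y :: real assume "x \<in> {0..}" "y \<in> {0..}" "x \<le> y"
  then show "\<phi> x \<le> \<phi> y"
    by (intro DERIV_nonneg_imp_nondecreasing[of x y \<phi>]) (auto intro!: deriv deriv_nonneg exI)
qed

lemma nonneg: "0 \<le> x \<Longrightarrow> 0 \<le> \<phi> x"
  using mono_onD[OF mono_on_half_line, of 0 x] by (simp add: zero)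

text \<open>Substitution is available on compact intervals, so it is applied on
  \<open>{0..n}\<close> and the half line is exhausted by monotone convergence; the image intervals
  exhaust it too because \<phi> is unbounded. Everything is restricted to nonnegative arguments,
  since a flow such as x + \<epsilon> x^(p+1) need not be monotone on the negative axis.\<close>

lemma emeasure_half_line:
  assumes [measurable]: "A \<in> sets borel"
  shows "(\<integral>\<^sup>+x. indicator {0..} x * indicator A x \<partial>lborel)
    = (\<integral>\<^sup>+x. ennreal (\<phi>' x) * indicator {0..} x * indicator A (\<phi> x) \<partial>lborel)"
proof -
  have eq: "(\<integral>\<^sup>+x. indicator A x * indicator {0..\<phi> (real n)} x \<partial>lborel)
      = (\<integral>\<^sup>+x. ennreal (\<phi>' x) * indicator A (\<phi> x) * indicator {0..real n} x \<partial>lborel)" for n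
  proof -
    have "(\<integral>\<^sup>+x. ennreal (indicator A x * indicator {\<phi> 0..\<phi> (real n)} x) \<partial>lborel)
      = (\<integral>\<^sup>+x. ennreal (indicator A (\<phi> x) * \<phi>' x * indicator {0..real n} x) \<partial>lborel)"
      by (rule nn_integral_substitution)
        (auto intro!: deriv deriv_nonneg continuous_on_subset[OF cont_deriv]
          simp: set_borel_measurable_def)
    also have "(\<integral>\<^sup>+x. ennreal (indicator A (\<phi> x) * \<phi>' x * indicator {0..real n} x) \<partial>lborel)
        = (\<integral>\<^sup>+x. ennreal (\<phi>' x) * indicator A (\<phi> x) * indicator {0..real n} x \<partial>lborel)"
      by (intro nn_integral_cong) (auto simp: indicator_def)
    also have "(\<integral>\<^sup>+x. ennreal (indicator A x * indicator {\<phi> 0..\<phi> (real n)} x) \<partial>lborel)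
        = (\<integral>\<^sup>+x. indicator A x * indicator {0..\<phi> (real n)} x \<partial>lborel)"
      by (intro nn_integral_cong) (auto simp: indicator_def zero)
    finally show ?thesis .
  qed
  have SUP_indicator: "(SUP n. c * indicator {0..f n} x) = c * indicator {0..} x"
    if f: "filterlim f at_top sequentially" and "0 \<le> x" for f :: "nat \<Rightarrow> real" and c :: ennreal and x
  proof (rule antisym)
    show "(SUP n. c * indicator {0..f n} x) \<le> c * indicator {0..} x"
      by (intro SUP_least) (auto simp: indicator_def)
    obtain n where "x \<le> f n"
      using f[unfolded filterlim_at_top, rule_format, of x] by (auto simp: eventually_sequentially)
    then show "c * indicator {0..} x \<le> (SUP n. c * indicator {0..f n} x)"
      using \<open>0 \<le> x\<close> by (intro SUP_upper2[of n]) (auto simp: indicator_def)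
  qed
  have inc: "incseq (\<lambda>n x. c x * indicator {0..f n} x)"
    if "incseq f" for c :: "real \<Rightarrow> ennreal" and f :: "nat \<Rightarrow> real"
    using that by (fastforce simp: incseq_def le_fun_def indicator_def intro: order_trans)
  have f1: "filterlim (\<lambda>n. \<phi> (real n)) at_top sequentially"
    by (rule filterlim_compose[OF unbounded filterlim_real_sequentially])
  have i1: "incseq (\<lambda>n. \<phi> (real n))"
    by (auto simp: incseq_def intro!: mono_onD[OF mono_on_half_line])
  have "(\<integral>\<^sup>+x. indicator {0..} x * indicator A x \<partial>lborel)
      = (\<integral>\<^sup>+x. (SUP n. indicator A x * indicator {0..\<phi> (real n)} x) \<partial>lborel)"
  proof (intro nn_integral_cong)
    fix x :: real
    show "indicator {0..} x * indicator A x = (SUP n. indicator A x * indicator {0..\<phi> (real n)} x :: ennreal)"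
      using SUP_indicator[OF f1, of x "indicator A x"] by (cases "0 \<le> x") (auto simp: mult.commute)
  qed
  also have "\<dots> = (SUP n. \<integral>\<^sup>+x. indicator A x * indicator {0..\<phi> (real n)} x \<partial>lborel)"
    by (intro nn_integral_monotone_convergence_SUP inc i1) auto
  also have "\<dots> = (SUP n. \<integral>\<^sup>+x. ennreal (\<phi>' x) * indicator A (\<phi> x) * indicator {0..real n} x \<partial>lborel)"
    by (simp add: eq)
  also have "\<dots> = (\<integral>\<^sup>+x. (SUP n. ennreal (\<phi>' x) * indicator A (\<phi> x) * indicator {0..real n} x) \<partial>lborel)"
    by (intro nn_integral_monotone_convergence_SUP[symmetric] inc) (auto simp: incseq_def)
  also have "\<dots> = (\<integral>\<^sup>+x. ennreal (\<phi>' x) * indicator {0..} x * indicator A (\<phi> x) \<partial>lborel)"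
  proof (intro nn_integral_cong)
    fix x :: real
    show "(SUP n. ennreal (\<phi>' x) * indicator A (\<phi> x) * indicator {0..real n} x)
        = ennreal (\<phi>' x) * indicator {0..} x * indicator A (\<phi> x)"
      using SUP_indicator[OF filterlim_real_sequentially, of x "ennreal (\<phi>' x) * indicator A (\<phi> x)"]
      by (cases "0 \<le> x") (auto simp: mult_ac)
  qed
  finally show ?thesis .
qed

text \<open>The map acts coordinatewise, so its Jacobian is a product and no genuinely multivariate
  change of variables is needed. Both sides agree with the power of Lebesgue measure on the half
  line, since they have the same values on boxes.\<close>

lemma distr_PiM_lborel:
  fixes I :: "'i set"
  assumes I[simp]: "finite I"
  shows "density (PiM I (\<lambda>_. lborel)) (\<lambda>x. \<Prod>i\<in>I. indicator {0..} (x i))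
    = distr (density (PiM I (\<lambda>_. lborel)) (\<lambda>x. \<Prod>i\<in>I. ennreal (\<phi>' (x i)) * indicator {0..} (x i)))
        (PiM I (\<lambda>_. lborel)) (\<lambda>x. \<lambda>i\<in>I. \<phi> (x i))"
    (is "?L = ?R")
proof -
  define h :: "real measure" where "h = density lborel (indicator {0..})"
  interpret P: product_sigma_finite "\<lambda>_::'i. lborel :: real measure" by standard
  interpret H: product_sigma_finite "\<lambda>_::'i. h"
  proof (unfold product_sigma_finite_def, rule allI)
    have "sigma_finite_measure (density lborel (\<lambda>x::real. indicator {0..} x))"
      by (subst sigma_finite_measure.sigma_finite_iff_density_finite'[OF sigma_finite_lborel]) (auto simp: indicator_def)
    then show "sigma_finite_measure h" by (simp add: h_def)
  qed
  have sets_h[simp, measurable_cong]: "sets h = sets borel" by (simp add: h_def)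
  have setsP: "sets (PiM I (\<lambda>_. h)) = sets (PiM I (\<lambda>_::'i. lborel :: real measure))"
    by (intro sets_PiM_cong) auto
  have em_h: "emeasure h A = (\<integral>\<^sup>+x. indicator {0..} x * indicator A x \<partial>lborel)" if "A \<in> sets borel" for A
    using that by (simp add: h_def emeasure_density)
  have meas_T[measurable]: "(\<lambda>x. \<lambda>i\<in>I. \<phi> (x i)) \<in> measurable (PiM I (\<lambda>_. lborel)) (PiM I (\<lambda>_. lborel))"
    by (intro measurable_restrict) simp
  have box: "indicator (Pi\<^sub>E I A) x = (\<Prod>i\<in>I. indicator (A i) (x i) :: ennreal)"
    if "x \<in> extensional I" for A and x :: "'i \<Rightarrow> real"
    using that by (auto simp: indicator_def PiE_def Pi_def prod_zero_iff intro!: prod.neutral[symmetric])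
  have box_ext: "x \<in> extensional I" if "x \<in> space (PiM I (\<lambda>_. lborel))" for x :: "'i \<Rightarrow> real"
    using that by (auto simp: space_PiM PiE_def)
  have "?L = PiM I (\<lambda>_. h)"
  proof (rule H.PiM_eqI)
    fix A assume "\<And>i. i \<in> I \<Longrightarrow> A i \<in> sets h"
    then have A: "\<And>i. i \<in> I \<Longrightarrow> A i \<in> sets borel" by simp
    then have [measurable]: "Pi\<^sub>E I A \<in> sets (PiM I (\<lambda>_. lborel))"
      by (intro sets_PiM_I_finite) auto
    have "emeasure ?L (Pi\<^sub>E I A)
        = (\<integral>\<^sup>+x. (\<Prod>i\<in>I. indicator {0..} (x i)) * indicator (Pi\<^sub>E I A) x \<partial>PiM I (\<lambda>_. lborel))"
      by (subst emeasure_density) auto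
    also have "\<dots> = (\<integral>\<^sup>+x. (\<Prod>i\<in>I. indicator {0..} (x i) * indicator (A i) (x i)) \<partial>PiM I (\<lambda>_. lborel))"
      by (intro nn_integral_cong) (simp add: box[OF box_ext] prod.distrib)
    also have "\<dots> = (\<Prod>i\<in>I. \<integral>\<^sup>+x. indicator {0..} x * indicator (A i) x \<partial>lborel)"
      using A by (subst P.product_nn_integral_prod) auto
    finally show "emeasure ?L (Pi\<^sub>E I A) = (\<Prod>i\<in>I. emeasure h (A i))"
      using A by (simp add: em_h)
  qed (simp_all add: setsP)
  moreover have "?R = PiM I (\<lambda>_. h)"
  proof (rule H.PiM_eqI)
    fix A assume "\<And>i. i \<in> I \<Longrightarrow> A i \<in> sets h"
    then have A[measurable]: "\<And>i. i \<in> I \<Longrightarrow> A i \<in> sets borel" by simp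
    then have Am[measurable]: "Pi\<^sub>E I A \<in> sets (PiM I (\<lambda>_. lborel))"
      by (intro sets_PiM_I_finite) auto
    let ?T = "\<lambda>x. \<lambda>i\<in>I. \<phi> (x i)"
    have "emeasure ?R (Pi\<^sub>E I A) = (\<integral>\<^sup>+x. indicator (Pi\<^sub>E I A) x \<partial>?R)"
      by simp
    also have "\<dots> = (\<integral>\<^sup>+x. indicator (Pi\<^sub>E I A) (?T x) \<partial>density (PiM I (\<lambda>_. lborel)) (\<lambda>x. \<Prod>i\<in>I. ennreal (\<phi>' (x i)) * indicator {0..} (x i)))"
      by (subst nn_integral_distr) auto
    also have "\<dots> = (\<integral>\<^sup>+x. (\<Prod>i\<in>I. ennreal (\<phi>' (x i)) * indicator {0..} (x i)) * indicator (Pi\<^sub>E I A) (?T x) \<partial>PiM I (\<lambda>_. lborel))"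
      by (subst nn_integral_density) auto
    also have "\<dots> = (\<integral>\<^sup>+x. (\<Prod>i\<in>I. ennreal (\<phi>' (x i)) * indicator {0..} (x i) * indicator (A i) (\<phi> (x i))) \<partial>PiM I (\<lambda>_. lborel))"
      by (intro nn_integral_cong) (simp add: box prod.distrib)
    also have "\<dots> = (\<Prod>i\<in>I. \<integral>\<^sup>+x. ennreal (\<phi>' x) * indicator {0..} x * indicator (A i) (\<phi> x) \<partial>lborel)"
      by (subst P.product_nn_integral_prod) auto
    also have "\<dots> = (\<Prod>i\<in>I. emeasure h (A i))"
      using A by (intro prod.cong) (simp_all add: em_h emeasure_half_line)
    finally show "emeasure ?R (Pi\<^sub>E I A) = (\<Prod>i\<in>I. emeasure h (A i))" .
  qed (simp_all add: setsP)
  ultimately show ?thesis by simp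
qed

text \<open>The support condition makes the restriction to the orthant invisible for
  \<open>h\<close>. The equivalence of integrability is as important as the equality of integrals:
  it lets a dilation improve the decay known for the weight.\<close>

lemma PiM_lborel_substitution:
  fixes I :: "'i set" and h :: "('i \<Rightarrow> real) \<Rightarrow> real"
  assumes I[simp]: "finite I" and h[measurable]: "h \<in> borel_measurable (PiM I (\<lambda>_. lborel))"
    and supp: "\<And>x i. i \<in> I \<Longrightarrow> x i < 0 \<Longrightarrow> h x = 0"
  defines "k \<equiv> \<lambda>x. (\<Prod>i\<in>I. \<phi>' (x i) * indicator {0..} (x i)) * h (\<lambda>i\<in>I. \<phi> (x i))"
  shows "integrable (PiM I (\<lambda>_. lborel)) h \<longleftrightarrow> integrable (PiM I (\<lambda>_. lborel)) k"
    and "integral\<^sup>L (PiM I (\<lambda>_. lborel)) h = integral\<^sup>L (PiM I (\<lambda>_. lborel)) k"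
proof -
  let ?P = "PiM I (\<lambda>_. lborel) :: ('i \<Rightarrow> real) measure"
  let ?T = "\<lambda>x. \<lambda>i\<in>I. \<phi> (x i)"
  have T[measurable]: "?T \<in> measurable ?P ?P"
    by (intro measurable_restrict) simp
  define u where "u = (\<lambda>x. \<Prod>i\<in>I. indicator {0..} (x i :: real) :: real)"
  define v where "v = (\<lambda>x. \<Prod>i\<in>I. \<phi>' (x i) * indicator {0..} (x i))"
  have [measurable]: "u \<in> borel_measurable ?P" "v \<in> borel_measurable ?P"
    by (auto simp: u_def v_def)
  have u0: "u x \<ge> 0" and v0: "v x \<ge> 0" for x
    by (auto simp: u_def v_def indicator_def deriv_nonneg intro!: prod_nonneg)
  have eu: "(\<Prod>i\<in>I. indicator {0..} (x i)) = ennreal (u x)" for x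
    by (auto simp: u_def ennreal_indicator prod_ennreal[symmetric])
  have ev: "(\<Prod>i\<in>I. ennreal (\<phi>' (x i)) * indicator {0..} (x i)) = ennreal (v x)" for x
  proof -
    have "ennreal (v x) = (\<Prod>i\<in>I. ennreal (\<phi>' (x i) * indicator {0..} (x i)))"
      unfolding v_def by (subst prod_ennreal) (auto simp: indicator_def deriv_nonneg)
    also have "\<dots> = (\<Prod>i\<in>I. ennreal (\<phi>' (x i)) * indicator {0..} (x i))"
      by (intro prod.cong) (auto simp: indicator_def)
    finally show ?thesis by simp
  qed
  have eq: "density ?P (\<lambda>x. ennreal (u x)) = distr (density ?P (\<lambda>x. ennreal (v x))) ?P ?T"
    using distr_PiM_lborel[OF I] by (simp only: eu ev)
  have uh: "u x * h x = h x" for x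
  proof (cases "\<forall>i\<in>I. 0 \<le> x i")
    case True then show ?thesis by (simp add: u_def)
  next
    case False
    then obtain i where "i \<in> I" "x i < 0" by (auto simp: not_le)
    then show ?thesis using supp[of i x] by simp
  qed
  have "integrable ?P h \<longleftrightarrow> integrable (density ?P (\<lambda>x. ennreal (u x))) h"
    by (subst integrable_density) (auto simp: u0 uh)
  also have "\<dots> \<longleftrightarrow> integrable ?P (\<lambda>x. v x * h (?T x))"
    unfolding eq by (subst integrable_distr_eq, simp, simp, subst integrable_density) (auto simp: v0)
  finally show "integrable ?P h \<longleftrightarrow> integrable ?P k" by (simp add: k_def v_def)
  have "integral\<^sup>L ?P h = integral\<^sup>L (density ?P (\<lambda>x. ennreal (u x))) h"
    by (subst integral_density) (auto simp: u0 uh)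
  also have "\<dots> = integral\<^sup>L ?P (\<lambda>x. v x * h (?T x))"
    unfolding eq by (subst integral_distr, simp, simp, subst integral_density) (auto simp: v0)
  finally show "integral\<^sup>L ?P h = integral\<^sup>L ?P k" by (simp add: k_def v_def)
qed

end

section \<open>Polynomially bounded functions and the Laguerre weight\<close>

abbreviation lborel_power :: "nat \<Rightarrow> (nat \<Rightarrow> real) measure" where
  "lborel_power N \<equiv> PiM {..<N} (\<lambda>_. lborel)"

lemma laguerre_weight_measurable[measurable]:
  "laguerre_weight \<alpha>\<^sub>1 \<beta> N \<in> borel_measurable (lborel_power N)"
proof -
  have [measurable]: "Measurable.pred (lborel_power N) (\<lambda>x. \<forall>l<N. 0 < x l)"
  proof -
    have "(\<lambda>x. \<forall>l<N. 0 < x l) = (\<lambda>x::nat \<Rightarrow> real. \<forall>l\<in>{..<N}. 0 < x l)" by auto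
    then show ?thesis by simp
  qed
  have comp: "(\<lambda>x. x i) \<in> borel_measurable (lborel_power N)" if "i < N" for i
    using that by simp
  have "(\<lambda>x. \<Prod>l<N. x l powr \<alpha>\<^sub>1 * exp (- x l)) \<in> borel_measurable (lborel_power N)"
    by (intro borel_measurable_prod borel_measurable_times powr_real_measurable borel_measurable_const
        measurable_compose[OF _ borel_measurable_exp] borel_measurable_uminus comp) auto
  moreover have "(\<lambda>x. \<Prod>k<N. \<Prod>j<k. \<bar>x k - x j\<bar> powr \<beta>) \<in> borel_measurable (lborel_power N)"
    by (intro borel_measurable_prod measurable_abs_powr borel_measurable_diff comp) auto
  ultimately show ?thesis
    unfolding laguerre_weight_def[abs_def]
    by (intro measurable_If borel_measurable_times borel_measurable_const) simp_all
qed

lemma laguerre_weight_nonneg: "0 \<le> laguerre_weight \<alpha>\<^sub>1 \<beta> N x"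
  by (auto simp: laguerre_weight_def intro!: prod_nonneg mult_nonneg_nonneg)

lemma laguerre_weight_eq_0: "\<not> (\<forall>l<N. 0 < x l) \<Longrightarrow> laguerre_weight \<alpha>\<^sub>1 \<beta> N x = 0"
  unfolding laguerre_weight_def by (rule if_not_P)

text \<open>The bound is required only where the weight can be nonzero. A power of 1 plus the
  coordinate sum is a convenient majorant: it is at least 1, so sums and products are absorbed by
  adding exponents, and it depends on the same quantity as the exponential factor of the
  weight.\<close>

definition poly_bounded :: "nat \<Rightarrow> ((nat \<Rightarrow> real) \<Rightarrow> real) \<Rightarrow> bool" where
  "poly_bounded N f \<longleftrightarrow> f \<in> borel_measurable (lborel_power N) \<and>
     (\<exists>C M. 0 \<le> C \<and> (\<forall>x. (\<forall>l<N. 0 < x l) \<longrightarrow> \<bar>f x\<bar> \<le> C * (1 + (\<Sum>l<N. x l)) ^ M))"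

lemma poly_bounded_measurable[measurable_dest]:
  "poly_bounded N f \<Longrightarrow> f \<in> borel_measurable (lborel_power N)"
  by (simp add: poly_bounded_def)

lemma poly_bounded_const: "poly_bounded N (\<lambda>_. c)"
  unfolding poly_bounded_def by (intro conjI exI[of _ "\<bar>c\<bar>"] exI[of _ 0]) auto

lemma poly_bounded_component: "j < N \<Longrightarrow> poly_bounded N (\<lambda>x. x j)"
  unfolding poly_bounded_def
proof (intro conjI exI[of _ 1] allI impI)
  fix x :: "nat \<Rightarrow> real" assume j: "j < N" and x: "\<forall>l<N. 0 < x l"
  have "x j \<le> (\<Sum>l<N. x l)"
    using j x by (intro member_le_sum) (auto intro: less_imp_le)
  then show "\<bar>x j\<bar> \<le> 1 * (1 + (\<Sum>l<N. x l)) ^ 1" using x j by (auto simp: abs_of_pos)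
qed auto

lemma poly_bounded_mono:
  assumes "poly_bounded N g" and "f \<in> borel_measurable (lborel_power N)"
    and "\<And>x. \<forall>l<N. 0 < x l \<Longrightarrow> \<bar>f x\<bar> \<le> \<bar>g x\<bar>"
  shows "poly_bounded N f"
  using assms unfolding poly_bounded_def by (meson order_trans)

lemma poly_bounded_abs: "poly_bounded N f \<Longrightarrow> poly_bounded N (\<lambda>x. \<bar>f x\<bar>)"
  by (rule poly_bounded_mono) auto

lemma poly_bounded_add:
  assumes "poly_bounded N f" "poly_bounded N g"
  shows "poly_bounded N (\<lambda>x. f x + g x)"
proof -
  obtain C M where f: "0 \<le> C" "\<And>x. \<forall>l<N. 0 < x l \<Longrightarrow> \<bar>f x\<bar> \<le> C * (1 + (\<Sum>l<N. x l)) ^ M"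
    using assms(1) unfolding poly_bounded_def by blast
  obtain D K where g: "0 \<le> D" "\<And>x. \<forall>l<N. 0 < x l \<Longrightarrow> \<bar>g x\<bar> \<le> D * (1 + (\<Sum>l<N. x l)) ^ K"
    using assms(2) unfolding poly_bounded_def by blast
  have "\<bar>f x + g x\<bar> \<le> (C + D) * (1 + (\<Sum>l<N. x l)) ^ (M + K)" if x: "\<forall>l<N. 0 < x l" for x
  proof -
    have s: "0 \<le> (\<Sum>l<N. x l)" using x by (intro sum_nonneg) (auto intro: less_imp_le)
    have "C * (1 + (\<Sum>l<N. x l)) ^ M \<le> C * (1 + (\<Sum>l<N. x l)) ^ (M + K)"
      and "D * (1 + (\<Sum>l<N. x l)) ^ K \<le> D * (1 + (\<Sum>l<N. x l)) ^ (M + K)"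
      using s f(1) g(1) by (auto intro!: mult_left_mono power_increasing)
    then show ?thesis using f(2)[OF x] g(2)[OF x] by (simp add: distrib_right)
  qed
  then show ?thesis
    using assms f(1) g(1) unfolding poly_bounded_def
    by (intro conjI exI[of _ "C + D"] exI[of _ "M + K"]) auto
qed

lemma poly_bounded_mult:
  assumes "poly_bounded N f" "poly_bounded N g"
  shows "poly_bounded N (\<lambda>x. f x * g x)"
proof -
  obtain C M where f: "0 \<le> C" "\<And>x. \<forall>l<N. 0 < x l \<Longrightarrow> \<bar>f x\<bar> \<le> C * (1 + (\<Sum>l<N. x l)) ^ M"
    using assms(1) unfolding poly_bounded_def by blast
  obtain D K where g: "0 \<le> D" "\<And>x. \<forall>l<N. 0 < x l \<Longrightarrow> \<bar>g x\<bar> \<le> D * (1 + (\<Sum>l<N. x l)) ^ K"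
    using assms(2) unfolding poly_bounded_def by blast
  have "\<bar>f x * g x\<bar> \<le> (C * D) * (1 + (\<Sum>l<N. x l)) ^ (M + K)" if x: "\<forall>l<N. 0 < x l" for x
  proof -
    have s: "0 \<le> (\<Sum>l<N. x l)" using x by (intro sum_nonneg) (auto intro: less_imp_le)
    have "\<bar>f x\<bar> * \<bar>g x\<bar> \<le> (C * (1 + (\<Sum>l<N. x l)) ^ M) * (D * (1 + (\<Sum>l<N. x l)) ^ K)"
      using s f(1) by (intro mult_mono f(2)[OF x] g(2)[OF x]) auto
    then show ?thesis by (simp add: abs_mult power_add mult_ac)
  qed
  then show ?thesis
    using assms f(1) g(1) unfolding poly_bounded_def
    by (intro conjI exI[of _ "C * D"] exI[of _ "M + K"]) auto
qed

lemma poly_bounded_diff: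
  "poly_bounded N f \<Longrightarrow> poly_bounded N g \<Longrightarrow> poly_bounded N (\<lambda>x. f x - g x)"
  using poly_bounded_add[of N f "\<lambda>x. -1 * g x"] poly_bounded_mult[OF poly_bounded_const, of N g "-1"]
  by simp

lemma poly_bounded_power: "poly_bounded N f \<Longrightarrow> poly_bounded N (\<lambda>x. f x ^ n)"
  by (induction n) (auto intro: poly_bounded_const poly_bounded_mult)

lemma poly_bounded_sum:
  "(\<And>i. i \<in> I \<Longrightarrow> poly_bounded N (f i)) \<Longrightarrow> poly_bounded N (\<lambda>x. \<Sum>i\<in>I. f i x)"
  by (induction I rule: infinite_finite_induct) (auto intro: poly_bounded_const poly_bounded_add)

lemma poly_bounded_sum_mset:
  "(\<And>i. i \<in># I \<Longrightarrow> poly_bounded N (f i)) \<Longrightarrow> poly_bounded N (\<lambda>x. \<Sum>i\<in>#I. f i x)"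
  by (induction I) (auto intro: poly_bounded_const poly_bounded_add)

lemma poly_bounded_prod_mset:
  "(\<And>i. i \<in># I \<Longrightarrow> poly_bounded N (f i)) \<Longrightarrow> poly_bounded N (\<lambda>x. \<Prod>i\<in>#I. f i x)"
  by (induction I) (auto intro: poly_bounded_const poly_bounded_mult)

lemma poly_bounded_linear_statistic: "poly_bounded N (linear_statistic N (\<lambda>t. t ^ a))"
  unfolding linear_statistic_def[abs_def]
  by (intro poly_bounded_sum poly_bounded_power poly_bounded_component) simp

lemmas poly_bounded_intros = poly_bounded_const poly_bounded_component poly_bounded_add
  poly_bounded_mult poly_bounded_diff poly_bounded_power poly_bounded_sum poly_bounded_sum_mset
  poly_bounded_prod_mset poly_bounded_linear_statistic poly_bounded_abs

text \<open>Apart from the exponential factor the weight is homogeneous, so the dilation \<open>x \<mapsto> x/2\<close>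
  trades half of the exponential decay for a constant.\<close>

lemma laguerre_weight_half:
  "laguerre_weight \<alpha>\<^sub>1 \<beta> N (\<lambda>i\<in>{..<N}. x i / 2)
    = (\<Prod>l<N. (1/2) powr \<alpha>\<^sub>1) * (\<Prod>k<N. \<Prod>j<k. (1/2) powr \<beta>)
        * (laguerre_weight \<alpha>\<^sub>1 \<beta> N x * exp ((\<Sum>l<N. x l) / 2))"
proof (cases "\<forall>l<N. 0 < x l")
  case True
  have shuffle: "a * b * e * (c * d) = a * c * (b * d * e)" for a b c d e :: real by simp
  have a: "(x l / 2) powr \<alpha>\<^sub>1 * exp (- (x l / 2))
      = (1/2) powr \<alpha>\<^sub>1 * (x l powr \<alpha>\<^sub>1 * exp (- x l)) * exp (x l / 2)" if "l < N" for l
  proof -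
    have "(x l / 2) powr \<alpha>\<^sub>1 = (1/2) powr \<alpha>\<^sub>1 * x l powr \<alpha>\<^sub>1"
      using True that by (subst powr_mult[symmetric]) (auto intro: less_imp_le)
    moreover have "exp (- (x l / 2)) = exp (- x l) * exp (x l / 2)"
      by (simp add: exp_add[symmetric])
    ultimately show ?thesis by simp
  qed
  have b: "\<bar>x k / 2 - x j / 2\<bar> powr \<beta> = (1/2) powr \<beta> * \<bar>x k - x j\<bar> powr \<beta>" for k j
  proof -
    have "\<bar>x k / 2 - x j / 2\<bar> = 1/2 * \<bar>x k - x j\<bar>" by (simp add: abs_if field_simps)
    then show ?thesis by (simp only:) (subst powr_mult, auto)
  qed
  have "laguerre_weight \<alpha>\<^sub>1 \<beta> N (\<lambda>i\<in>{..<N}. x i / 2)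
    = (\<Prod>l<N. (x l / 2) powr \<alpha>\<^sub>1 * exp (- (x l / 2))) * (\<Prod>k<N. \<Prod>j<k. \<bar>x k / 2 - x j / 2\<bar> powr \<beta>)"
    using True by (auto simp: laguerre_weight_def intro!: prod.cong arg_cong2[of _ _ _ _ "(*)"])
  also have "(\<Prod>l<N. (x l / 2) powr \<alpha>\<^sub>1 * exp (- (x l / 2)))
      = (\<Prod>l<N. (1/2) powr \<alpha>\<^sub>1) * (\<Prod>l<N. x l powr \<alpha>\<^sub>1 * exp (- x l)) * exp ((\<Sum>l<N. x l) / 2)"
    by (simp add: a prod.distrib exp_sum sum_divide_distrib cong: prod.cong_simp del: prod_constant)
  also have "(\<Prod>k<N. \<Prod>j<k. \<bar>x k / 2 - x j / 2\<bar> powr \<beta>)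
      = (\<Prod>k<N. \<Prod>j<k. (1/2) powr \<beta>) * (\<Prod>k<N. \<Prod>j<k. \<bar>x k - x j\<bar> powr \<beta>)"
    by (simp only: b prod.distrib)
  also have "(\<Prod>l<N. (1/2) powr \<alpha>\<^sub>1) * (\<Prod>l<N. x l powr \<alpha>\<^sub>1 * exp (- x l)) * exp ((\<Sum>l<N. x l) / 2)
      * ((\<Prod>k<N. \<Prod>j<k. (1/2) powr \<beta>) * (\<Prod>k<N. \<Prod>j<k. \<bar>x k - x j\<bar> powr \<beta>))
      = (\<Prod>l<N. (1/2) powr \<alpha>\<^sub>1) * (\<Prod>k<N. \<Prod>j<k. (1/2) powr \<beta>)
        * (((\<Prod>l<N. x l powr \<alpha>\<^sub>1 * exp (- x l)) * (\<Prod>k<N. \<Prod>j<k. \<bar>x k - x j\<bar> powr \<beta>))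
          * exp ((\<Sum>l<N. x l) / 2))"
    by (rule shuffle)
  also have "(\<Prod>l<N. x l powr \<alpha>\<^sub>1 * exp (- x l)) * (\<Prod>k<N. \<Prod>j<k. \<bar>x k - x j\<bar> powr \<beta>)
      = laguerre_weight \<alpha>\<^sub>1 \<beta> N x"
    unfolding laguerre_weight_def by (rule if_P[OF True, symmetric])
  finally show ?thesis .
next
  case False
  then have "\<not> (\<forall>l<N. 0 < (\<lambda>i\<in>{..<N}. x i / 2) l)" by auto
  then show ?thesis
    by (simp only: laguerre_weight_eq_0[OF False] laguerre_weight_eq_0[OF \<open>\<not> (\<forall>l<N. 0 < (\<lambda>i\<in>{..<N}. x i / 2) l)\<close>] mult_zero_left mult_zero_right)
qed

text \<open>One term, that of index \<open>M\<close>, of the exponential series at (1 + s)/2 gives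
  the bound; the 1 in the argument is responsible for the factor \<open>exp (1/2)\<close>.\<close>

lemma power_le_exp_half:
  fixes s :: real
  assumes "0 \<le> s"
  shows "(1 + s) ^ M \<le> 2 ^ M * fact M * exp (1/2) * exp (s / 2)"
proof -
  have "((1 + s) / 2) ^ M / fact M \<le> exp ((1 + s) / 2)"
  proof -
    let ?t = "(1 + s) / 2"
    have "(\<Sum>n\<in>{M}. inverse (fact n) * ?t ^ n) \<le> (\<Sum>n. inverse (fact n) * ?t ^ n)"
      using summable_exp[of ?t] assms by (intro sum_le_suminf) auto
    then have "?t ^ M * inverse (fact M) \<le> exp ?t"
      by (simp only: exp_def sum.insert finite.emptyI empty_iff not_False_eq_True sum.empty
          add_0_right real_scaleR_def mult.commute)
    then show ?thesis by (simp only: divide_inverse)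
  qed
  also have "exp ((1 + s) / 2) = exp (1/2) * exp (s / 2)"
    by (simp add: exp_add[symmetric] add_divide_distrib)
  finally have "(1 + s) ^ M / 2 ^ M / fact M \<le> exp (1/2) * exp (s / 2)" by (simp add: power_divide)
  then show ?thesis by (simp add: field_simps)
qed

text \<open>No estimate of the Vandermonde factor is needed. Substituting x/2 in the integrable
  weight shows that the weight times exp of half the coordinate sum is still integrable, and this
  dominates every polynomially bounded multiple. The argument is indifferent to the sign of
  \<beta>.\<close>

lemma integrable_laguerre_weight_mult:
  assumes int: "integrable (lborel_power N) (laguerre_weight \<alpha>\<^sub>1 \<beta> N)"
    and f: "poly_bounded N f"
  shows "integrable (lborel_power N) (\<lambda>x. laguerre_weight \<alpha>\<^sub>1 \<beta> N x * f x)"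
proof -
  let ?w = "laguerre_weight \<alpha>\<^sub>1 \<beta> N" and ?S = "\<lambda>x::nat \<Rightarrow> real. \<Sum>l<N. x l"
  interpret half_line_map "\<lambda>x. x / 2" "\<lambda>_. 1/2"
  proof
    show "filterlim (\<lambda>x::real. x / 2) at_top at_top"
      using filterlim_tendsto_pos_mult_at_top[OF tendsto_const, of "1/2" "\<lambda>x::real. x" at_top]
      by (simp add: filterlim_ident)
  qed (auto intro!: derivative_eq_intros)
  define c where "c = (\<Prod>l<N. (1/2) powr \<alpha>\<^sub>1) * (\<Prod>k<N. \<Prod>j<k. (1/2) powr \<beta>)"
  have c: "c > 0" unfolding c_def by (intro mult_pos_pos prod_pos) auto
  have "integrable (lborel_power N) (\<lambda>x. (\<Prod>i<N. 1 / 2 * indicat_real {0..} (x i))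
      * ?w (\<lambda>i\<in>{..<N}. x i / 2))"
    using int by (subst (asm) PiM_lborel_substitution(1)) (auto intro!: laguerre_weight_eq_0 dest: less_asym)
  also have "(\<lambda>x. (\<Prod>i<N. 1 / 2 * indicat_real {0..} (x i)) * ?w (\<lambda>i\<in>{..<N}. x i / 2))
      = (\<lambda>x. (1 / 2) ^ N * c * (?w x * exp (?S x / 2)))"
  proof
    fix x :: "nat \<Rightarrow> real"
    show "(\<Prod>i<N. 1 / 2 * indicat_real {0..} (x i)) * ?w (\<lambda>i\<in>{..<N}. x i / 2)
        = (1 / 2) ^ N * c * (?w x * exp (?S x / 2))"
    proof (cases "\<forall>l<N. 0 < x l")
      case True
      have "(\<Prod>i<N. 1 / 2 * indicat_real {0..} (x i)) = (\<Prod>i<N. 1 / 2)"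
        using True by (intro prod.cong) (auto simp: indicator_def)
      then show ?thesis by (simp add: laguerre_weight_half c_def)
    next
      case False
      then show ?thesis
        by (simp only: laguerre_weight_half laguerre_weight_eq_0[OF False] mult_zero_left mult_zero_right)
    qed
  qed
  finally have "integrable (lborel_power N) (\<lambda>x. ?w x * exp (?S x / 2))"
    using c by simp
  moreover obtain C M where C: "0 \<le> C" "\<And>x. \<forall>l<N. 0 < x l \<Longrightarrow> \<bar>f x\<bar> \<le> C * (1 + ?S x) ^ M"
    using f unfolding poly_bounded_def by blast
  ultimately have "integrable (lborel_power N)
      (\<lambda>x. C * (2 ^ M * fact M * exp (1/2)) * (?w x * exp (?S x / 2)))"
    by (intro integrable_mult_right)
  then show ?thesis
  proof (rule Bochner_Integration.integrable_bound)
    show "(\<lambda>x. ?w x * f x) \<in> borel_measurable (lborel_power N)"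
      using f by measurable
    show "AE x in lborel_power N. norm (?w x * f x)
        \<le> norm (C * (2 ^ M * fact M * exp (1/2)) * (?w x * exp (?S x / 2)))"
    proof (intro AE_I2)
      fix x :: "nat \<Rightarrow> real"
      show "norm (?w x * f x) \<le> norm (C * (2 ^ M * fact M * exp (1/2)) * (?w x * exp (?S x / 2)))"
      proof (cases "\<forall>l<N. 0 < x l")
        case True
        have "0 \<le> ?S x" using True by (intro sum_nonneg) (auto intro: less_imp_le)
        have "\<bar>f x\<bar> \<le> C * (1 + ?S x) ^ M" by (rule C(2)[OF True])
        also have "\<dots> \<le> C * (2 ^ M * fact M * exp (1/2) * exp (?S x / 2))"
          using C(1) \<open>0 \<le> ?S x\<close> by (intro mult_left_mono power_le_exp_half)
        finally have "?w x * \<bar>f x\<bar> \<le> ?w x * (C * (2 ^ M * fact M * exp (1/2) * exp (?S x / 2)))"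
          by (intro mult_left_mono laguerre_weight_nonneg)
        then show ?thesis
          using C(1) by (simp add: abs_mult laguerre_weight_nonneg mult_ac)
      next
        case False
        then show ?thesis by (simp only: laguerre_weight_eq_0[OF False] mult_zero_left mult_zero_right)
      qed
    qed
  qed
qed

section \<open>Differentiation along a flow\<close>

text \<open>The second component bounds both the values and the difference quotients in the flow
  parameter, which is the domination needed to differentiate under the integral sign.\<close>

definition flow_differentiable ::
    "nat \<Rightarrow> (real \<Rightarrow> (nat \<Rightarrow> real) \<Rightarrow> real) \<Rightarrow> ((nat \<Rightarrow> real) \<Rightarrow> real) \<Rightarrow> bool" where
  "flow_differentiable N u d \<longleftrightarrow>
     (\<forall>\<epsilon>\<in>{0..1}. u \<epsilon> \<in> borel_measurable (lborel_power N)) \<and>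
     (\<exists>B. poly_bounded N B \<and> (\<forall>x. (\<forall>l<N. 0 < x l) \<longrightarrow>
        (\<forall>\<epsilon>\<in>{0..1}. \<bar>u \<epsilon> x\<bar> \<le> B x \<and> \<bar>u \<epsilon> x - u 0 x\<bar> \<le> \<epsilon> * B x))) \<and>
     (\<forall>x. (\<forall>l<N. 0 < x l) \<longrightarrow> ((\<lambda>\<epsilon>. u \<epsilon> x) has_real_derivative d x) (at 0))"

lemma flow_differentiableE:
  assumes "flow_differentiable N u d"
  obtains B where "\<And>\<epsilon>. \<epsilon> \<in> {0..1} \<Longrightarrow> u \<epsilon> \<in> borel_measurable (lborel_power N)" "poly_bounded N B"
    "\<And>x \<epsilon>. \<forall>l<N. 0 < x l \<Longrightarrow> \<epsilon> \<in> {0..1} \<Longrightarrow> \<bar>u \<epsilon> x\<bar> \<le> B x"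
    "\<And>x \<epsilon>. \<forall>l<N. 0 < x l \<Longrightarrow> \<epsilon> \<in> {0..1} \<Longrightarrow> \<bar>u \<epsilon> x - u 0 x\<bar> \<le> \<epsilon> * B x"
    "\<And>x. \<forall>l<N. 0 < x l \<Longrightarrow> ((\<lambda>\<epsilon>. u \<epsilon> x) has_real_derivative d x) (at 0)"
  using assms unfolding flow_differentiable_def by blast

lemma flow_differentiableI:
  assumes "\<And>\<epsilon>. \<epsilon> \<in> {0..1} \<Longrightarrow> u \<epsilon> \<in> borel_measurable (lborel_power N)" "poly_bounded N B"
    "\<And>x \<epsilon>. \<forall>l<N. 0 < x l \<Longrightarrow> \<epsilon> \<in> {0..1} \<Longrightarrow> \<bar>u \<epsilon> x\<bar> \<le> B x"
    "\<And>x \<epsilon>. \<forall>l<N. 0 < x l \<Longrightarrow> \<epsilon> \<in> {0..1} \<Longrightarrow> \<bar>u \<epsilon> x - u 0 x\<bar> \<le> \<epsilon> * B x"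
    "\<And>x. \<forall>l<N. 0 < x l \<Longrightarrow> ((\<lambda>\<epsilon>. u \<epsilon> x) has_real_derivative d x) (at 0)"
  shows "flow_differentiable N u d"
  using assms unfolding flow_differentiable_def by blast

lemma flow_differentiable_cong:
  assumes "flow_differentiable N u d" "\<And>x. \<forall>l<N. 0 < x l \<Longrightarrow> d x = d' x"
  shows "flow_differentiable N u d'"
  using assms unfolding flow_differentiable_def by auto

section \<open>Calculus rules for flow-differentiable families\<close>

lemma flow_differentiable_const:
  assumes "poly_bounded N f"
  shows "flow_differentiable N (\<lambda>_. f) (\<lambda>_. 0)"
proof (rule flow_differentiableI)
  show "poly_bounded N (\<lambda>x. \<bar>f x\<bar>)" by (intro poly_bounded_intros assms)
qed (use assms in auto)

lemma flow_differentiable_linear: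
  assumes f: "poly_bounded N f"
  shows "flow_differentiable N (\<lambda>\<epsilon> x. \<epsilon> * f x) f"
proof (rule flow_differentiableI)
  show "poly_bounded N (\<lambda>x. \<bar>f x\<bar>)" by (intro poly_bounded_intros f)
qed (use f in \<open>auto simp: abs_mult mult_left_le_one_le intro!: derivative_eq_intros\<close>)

lemma flow_differentiable_add:
  assumes "flow_differentiable N u d" "flow_differentiable N v e"
  shows "flow_differentiable N (\<lambda>\<epsilon> x. u \<epsilon> x + v \<epsilon> x) (\<lambda>x. d x + e x)"
proof -
  obtain A where u: "\<And>\<epsilon>. \<epsilon> \<in> {0..1} \<Longrightarrow> u \<epsilon> \<in> borel_measurable (lborel_power N)" "poly_bounded N A"
    "\<And>x \<epsilon>. \<forall>l<N. 0 < x l \<Longrightarrow> \<epsilon> \<in> {0..1} \<Longrightarrow> \<bar>u \<epsilon> x\<bar> \<le> A x"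
    "\<And>x \<epsilon>. \<forall>l<N. 0 < x l \<Longrightarrow> \<epsilon> \<in> {0..1} \<Longrightarrow> \<bar>u \<epsilon> x - u 0 x\<bar> \<le> \<epsilon> * A x"
    "\<And>x. \<forall>l<N. 0 < x l \<Longrightarrow> ((\<lambda>\<epsilon>. u \<epsilon> x) has_real_derivative d x) (at 0)"
    using assms(1) by (rule flow_differentiableE) (rule that)
  obtain B where v: "\<And>\<epsilon>. \<epsilon> \<in> {0..1} \<Longrightarrow> v \<epsilon> \<in> borel_measurable (lborel_power N)" "poly_bounded N B"
    "\<And>x \<epsilon>. \<forall>l<N. 0 < x l \<Longrightarrow> \<epsilon> \<in> {0..1} \<Longrightarrow> \<bar>v \<epsilon> x\<bar> \<le> B x"
    "\<And>x \<epsilon>. \<forall>l<N. 0 < x l \<Longrightarrow> \<epsilon> \<in> {0..1} \<Longrightarrow> \<bar>v \<epsilon> x - v 0 x\<bar> \<le> \<epsilon> * B x"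
    "\<And>x. \<forall>l<N. 0 < x l \<Longrightarrow> ((\<lambda>\<epsilon>. v \<epsilon> x) has_real_derivative e x) (at 0)"
    using assms(2) by (rule flow_differentiableE) (rule that)
  show ?thesis
  proof (rule flow_differentiableI)
    show "poly_bounded N (\<lambda>x. A x + B x)" by (intro poly_bounded_intros u v)
  next
    fix x :: "nat \<Rightarrow> real" and \<epsilon> :: real assume a: "\<forall>l<N. 0 < x l" "\<epsilon> \<in> {0..1}"
    show "\<bar>u \<epsilon> x + v \<epsilon> x\<bar> \<le> A x + B x" using u(3)[OF a] v(3)[OF a] by linarith
    show "\<bar>u \<epsilon> x + v \<epsilon> x - (u 0 x + v 0 x)\<bar> \<le> \<epsilon> * (A x + B x)"
      using u(4)[OF a] v(4)[OF a] unfolding distrib_left by linarith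
  next
    fix \<epsilon> :: real assume "\<epsilon> \<in> {0..1}"
    then show "(\<lambda>x. u \<epsilon> x + v \<epsilon> x) \<in> borel_measurable (lborel_power N)"
      by (intro borel_measurable_add u v)
  qed (intro DERIV_add u v)
qed

lemma flow_differentiable_mult:
  assumes "flow_differentiable N u d" "flow_differentiable N v e"
  shows "flow_differentiable N (\<lambda>\<epsilon> x. u \<epsilon> x * v \<epsilon> x) (\<lambda>x. d x * v 0 x + u 0 x * e x)"
proof -
  obtain A where u: "\<And>\<epsilon>. \<epsilon> \<in> {0..1} \<Longrightarrow> u \<epsilon> \<in> borel_measurable (lborel_power N)" "poly_bounded N A"
    "\<And>x \<epsilon>. \<forall>l<N. 0 < x l \<Longrightarrow> \<epsilon> \<in> {0..1} \<Longrightarrow> \<bar>u \<epsilon> x\<bar> \<le> A x"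
    "\<And>x \<epsilon>. \<forall>l<N. 0 < x l \<Longrightarrow> \<epsilon> \<in> {0..1} \<Longrightarrow> \<bar>u \<epsilon> x - u 0 x\<bar> \<le> \<epsilon> * A x"
    "\<And>x. \<forall>l<N. 0 < x l \<Longrightarrow> ((\<lambda>\<epsilon>. u \<epsilon> x) has_real_derivative d x) (at 0)"
    using assms(1) by (rule flow_differentiableE) (rule that)
  obtain B where v: "\<And>\<epsilon>. \<epsilon> \<in> {0..1} \<Longrightarrow> v \<epsilon> \<in> borel_measurable (lborel_power N)" "poly_bounded N B"
    "\<And>x \<epsilon>. \<forall>l<N. 0 < x l \<Longrightarrow> \<epsilon> \<in> {0..1} \<Longrightarrow> \<bar>v \<epsilon> x\<bar> \<le> B x"
    "\<And>x \<epsilon>. \<forall>l<N. 0 < x l \<Longrightarrow> \<epsilon> \<in> {0..1} \<Longrightarrow> \<bar>v \<epsilon> x - v 0 x\<bar> \<le> \<epsilon> * B x"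
    "\<And>x. \<forall>l<N. 0 < x l \<Longrightarrow> ((\<lambda>\<epsilon>. v \<epsilon> x) has_real_derivative e x) (at 0)"
    using assms(2) by (rule flow_differentiableE) (rule that)
  show ?thesis
  proof (rule flow_differentiableI)
    \<comment> \<open>The factor 2 pays for the two terms of the telescoped difference u v - u0 v0 =
      (u - u0) v + u0 (v - v0), each bounded by \<epsilon> A B.\<close>
    show "poly_bounded N (\<lambda>x. 2 * (A x * B x))" by (intro poly_bounded_intros u v)
  next
    fix x :: "nat \<Rightarrow> real" and \<epsilon> :: real assume a: "\<forall>l<N. 0 < x l" "\<epsilon> \<in> {0..1}"
    have 0: "(0::real) \<in> {0..1}" by simp
    have nn: "0 \<le> A x" "0 \<le> B x" using u(3)[OF a] v(3)[OF a] by linarith+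
    have "\<bar>u \<epsilon> x * v \<epsilon> x\<bar> \<le> A x * B x"
      unfolding abs_mult using nn by (intro mult_mono u(3)[OF a] v(3)[OF a]) auto
    then show "\<bar>u \<epsilon> x * v \<epsilon> x\<bar> \<le> 2 * (A x * B x)" using mult_nonneg_nonneg[OF nn] by linarith
    have "u \<epsilon> x * v \<epsilon> x - u 0 x * v 0 x = (u \<epsilon> x - u 0 x) * v \<epsilon> x + u 0 x * (v \<epsilon> x - v 0 x)"
      by (simp add: algebra_simps)
    moreover have "\<bar>(u \<epsilon> x - u 0 x) * v \<epsilon> x\<bar> \<le> (\<epsilon> * A x) * B x"
      unfolding abs_mult using nn a(2) by (intro mult_mono u(4)[OF a] v(3)[OF a]) auto
    moreover have "\<bar>u 0 x * (v \<epsilon> x - v 0 x)\<bar> \<le> A x * (\<epsilon> * B x)"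
      unfolding abs_mult using nn a(2) by (intro mult_mono u(3)[OF a(1) 0] v(4)[OF a]) auto
    moreover have "\<epsilon> * (2 * (A x * B x)) = (\<epsilon> * A x) * B x + A x * (\<epsilon> * B x)" by simp
    ultimately show "\<bar>u \<epsilon> x * v \<epsilon> x - u 0 x * v 0 x\<bar> \<le> \<epsilon> * (2 * (A x * B x))"
      by linarith
  next
    fix \<epsilon> :: real assume "\<epsilon> \<in> {0..1}"
    then show "(\<lambda>x. u \<epsilon> x * v \<epsilon> x) \<in> borel_measurable (lborel_power N)"
      by (intro borel_measurable_times u v)
  next
    fix x :: "nat \<Rightarrow> real" assume a: "\<forall>l<N. 0 < x l"
    show "((\<lambda>\<epsilon>. u \<epsilon> x * v \<epsilon> x) has_real_derivative d x * v 0 x + u 0 x * e x) (at 0)"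
      using DERIV_mult[OF u(5)[OF a] v(5)[OF a]] by (simp add: mult_ac)
  qed
qed

lemma flow_differentiable_power:
  assumes "flow_differentiable N u d"
  shows "flow_differentiable N (\<lambda>\<epsilon> x. u \<epsilon> x ^ n) (\<lambda>x. real n * u 0 x ^ (n - 1) * d x)"
proof (induction n)
  case 0
  then show ?case using flow_differentiable_const[OF poly_bounded_const, of N 1] by simp
next
  case (Suc n)
  have "flow_differentiable N (\<lambda>\<epsilon> x. u \<epsilon> x * u \<epsilon> x ^ n)
      (\<lambda>x. d x * u 0 x ^ n + u 0 x * (real n * u 0 x ^ (n - 1) * d x))"
    by (rule flow_differentiable_mult[OF assms Suc.IH])
  then have "flow_differentiable N (\<lambda>\<epsilon> x. u \<epsilon> x ^ Suc n)
      (\<lambda>x. d x * u 0 x ^ n + u 0 x * (real n * u 0 x ^ (n - 1) * d x))"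
    by simp
  then show ?case
    by (rule flow_differentiable_cong) (cases n; simp add: algebra_simps)
qed

lemma flow_differentiable_sum:
  assumes "\<And>i. i \<in> I \<Longrightarrow> flow_differentiable N (u i) (d i)"
  shows "flow_differentiable N (\<lambda>\<epsilon> x. \<Sum>i\<in>I. u i \<epsilon> x) (\<lambda>x. \<Sum>i\<in>I. d i x)"
  using assms
proof (induction I rule: infinite_finite_induct)
  case (insert i I)
  then show ?case by (simp add: flow_differentiable_add)
qed (use flow_differentiable_const[OF poly_bounded_const, of N 0] in simp_all)

text \<open>All factors equal 1 at parameter 0, so the cofactors in the product rule disappear and
  the derivatives simply add, as logarithmic derivatives would.\<close>

lemma flow_differentiable_prod:
  assumes "\<And>i. i \<in> I \<Longrightarrow> flow_differentiable N (u i) (d i)"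
    and "\<And>i x. i \<in> I \<Longrightarrow> u i 0 x = 1"
  shows "flow_differentiable N (\<lambda>\<epsilon> x. \<Prod>i\<in>I. u i \<epsilon> x) (\<lambda>x. \<Sum>i\<in>I. d i x)"
  using assms
proof (induction I rule: infinite_finite_induct)
  case (insert i I)
  then have "flow_differentiable N (\<lambda>\<epsilon> x. u i \<epsilon> x * (\<Prod>i\<in>I. u i \<epsilon> x))
      (\<lambda>x. d i x * (\<Prod>i\<in>I. u i 0 x) + u i 0 x * (\<Sum>i\<in>I. d i x))"
    by (intro flow_differentiable_mult) auto
  then show ?case using insert by simp
qed (use flow_differentiable_const[OF poly_bounded_const, of N 1] in simp_all)

text \<open>This is the form needed for test functions, where the same power sum may occur several
  times; removing \<open>{#b#}\<close> deletes just one copy, the one that is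
  differentiated.\<close>

lemma flow_differentiable_prod_mset:
  assumes "\<And>a. a \<in># M \<Longrightarrow> flow_differentiable N (u a) (d a)"
  shows "flow_differentiable N (\<lambda>\<epsilon> x. \<Prod>a\<in>#M. u a \<epsilon> x)
    (\<lambda>x. \<Sum>b\<in>#M. d b x * (\<Prod>a\<in>#M - {#b#}. u a 0 x))"
  using assms
proof (induction M)
  case empty
  then show ?case using flow_differentiable_const[OF poly_bounded_const, of N 1] by simp
next
  case (add c M)
  have "flow_differentiable N (\<lambda>\<epsilon> x. u c \<epsilon> x * (\<Prod>a\<in>#M. u a \<epsilon> x))
    (\<lambda>x. d c x * (\<Prod>a\<in>#M. u a 0 x) + u c 0 x * (\<Sum>b\<in>#M. d b x * (\<Prod>a\<in>#M - {#b#}. u a 0 x)))"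
    using add by (intro flow_differentiable_mult) auto
  then have "flow_differentiable N (\<lambda>\<epsilon> x. \<Prod>a\<in>#add_mset c M. u a \<epsilon> x)
    (\<lambda>x. d c x * (\<Prod>a\<in>#M. u a 0 x) + u c 0 x * (\<Sum>b\<in>#M. d b x * (\<Prod>a\<in>#M - {#b#}. u a 0 x)))"
    by simp
  then show ?case
  proof (rule flow_differentiable_cong)
    fix x :: "nat \<Rightarrow> real"
    have "(\<Sum>b\<in>#M. d b x * (\<Prod>a\<in>#add_mset c M - {#b#}. u a 0 x))
        = (\<Sum>b\<in>#M. u c 0 x * (d b x * (\<Prod>a\<in>#M - {#b#}. u a 0 x)))"
    proof (intro arg_cong[where f = sum_mset] image_mset_cong)
      fix b assume "b \<in># M"
      then have "add_mset c M - {#b#} = add_mset c (M - {#b#})" by simp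
      then show "d b x * (\<Prod>a\<in>#add_mset c M - {#b#}. u a 0 x)
          = u c 0 x * (d b x * (\<Prod>a\<in>#M - {#b#}. u a 0 x))"
        by simp
    qed
    then show "d c x * (\<Prod>a\<in>#M. u a 0 x) + u c 0 x * (\<Sum>b\<in>#M. d b x * (\<Prod>a\<in>#M - {#b#}. u a 0 x))
        = (\<Sum>b\<in>#add_mset c M. d b x * (\<Prod>a\<in>#add_mset c M - {#b#}. u a 0 x))"
      by (simp add: sum_mset_distrib_left)
  qed
qed

lemma flow_differentiable_powr:
  assumes a: "poly_bounded N a" and a0: "\<And>x. \<forall>l<N. 0 < x l \<Longrightarrow> 0 \<le> a x"
  shows "flow_differentiable N (\<lambda>\<epsilon> x. (1 + \<epsilon> * a x) powr c) (\<lambda>x. c * a x)"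
proof -
  \<comment> \<open>This one integer exponent dominates both \<open>c\<close>, needed for the
    values, and \<open>c - 1\<close>, needed for the derivative, whatever the sign of
    \<open>c\<close>. Comparing exponents is legitimate because the base is at least 1, which uses
    \<epsilon> \<ge> 0.\<close>
  obtain n :: nat where n: "\<bar>c\<bar> + 1 \<le> real n" using real_arch_simple by blast
  have powr_le: "y powr b \<le> (1 + a x) ^ n"
    if "b \<le> real n" "1 \<le> y" "y \<le> 1 + a x" for y b x
  proof -
    have "y powr b \<le> y powr real n" using that by (intro powr_mono) auto
    also have "\<dots> = y ^ n" using that by (simp add: powr_realpow)
    also have "\<dots> \<le> (1 + a x) ^ n" using that by (intro power_mono) auto
    finally show ?thesis .
  qed
  show ?thesis
  proof (rule flow_differentiableI)
    show "poly_bounded N (\<lambda>x. (1 + \<bar>c\<bar> * a x) * (1 + a x) ^ n)"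
      by (intro poly_bounded_intros a)
  next
    fix \<epsilon> :: real
    show "(\<lambda>x. (1 + \<epsilon> * a x) powr c) \<in> borel_measurable (lborel_power N)" using a by measurable
  next
    fix x :: "nat \<Rightarrow> real" and \<epsilon> :: real assume x: "\<forall>l<N. 0 < x l" and \<epsilon>: "\<epsilon> \<in> {0..1}"
    have ax: "0 \<le> a x" by (rule a0[OF x])
    have le: "1 \<le> 1 + t * a x" "1 + t * a x \<le> 1 + a x" if "t \<in> {0..1}" for t
      using ax that by (auto simp: mult_left_le_one_le)
    have "\<bar>(1 + \<epsilon> * a x) powr c\<bar> \<le> 1 * (1 + a x) ^ n"
      using n powr_le[OF _ le[OF \<epsilon>], of c] by simp
    also have "\<dots> \<le> (1 + \<bar>c\<bar> * a x) * (1 + a x) ^ n"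
      using ax by (intro mult_right_mono) auto
    finally show "\<bar>(1 + \<epsilon> * a x) powr c\<bar> \<le> (1 + \<bar>c\<bar> * a x) * (1 + a x) ^ n" .
    show "\<bar>(1 + \<epsilon> * a x) powr c - (1 + 0 * a x) powr c\<bar> \<le> \<epsilon> * ((1 + \<bar>c\<bar> * a x) * (1 + a x) ^ n)"
    proof (cases "\<epsilon> = 0")
      case False
      then have "0 < \<epsilon>" using \<epsilon> by simp
      have "\<exists>z>0. z < \<epsilon> \<and> (1 + \<epsilon> * a x) powr c - (1 + 0 * a x) powr c
          = (\<epsilon> - 0) * (c * a x * (1 + z * a x) powr (c - 1))"
      proof (rule MVT2[OF \<open>0 < \<epsilon>\<close>])
        fix t assume "0 \<le> t" "t \<le> \<epsilon>"
        then have "1 + t * a x > 0" using le(1)[of t] \<epsilon> by auto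
        then show "((\<lambda>\<epsilon>. (1 + \<epsilon> * a x) powr c) has_real_derivative c * a x * (1 + t * a x) powr (c - 1)) (at t)"
          by (auto intro!: derivative_eq_intros simp: powr_diff field_simps)
      qed
      then obtain z where z: "0 < z" "z < \<epsilon>"
        and eq: "(1 + \<epsilon> * a x) powr c - (1 + 0 * a x) powr c = \<epsilon> * (c * a x * (1 + z * a x) powr (c - 1))"
        by auto
      have "(1 + z * a x) powr (c - 1) \<le> (1 + a x) ^ n"
        using z \<epsilon> n by (intro powr_le le) auto
      then have "\<bar>c\<bar> * a x * (1 + z * a x) powr (c - 1) \<le> (1 + \<bar>c\<bar> * a x) * (1 + a x) ^ n"
        using ax by (intro mult_mono) auto
      then show ?thesis
        using ax \<open>0 < \<epsilon>\<close> unfolding eq by (simp add: abs_mult)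
    qed simp
  next
    fix x :: "nat \<Rightarrow> real"
    show "((\<lambda>\<epsilon>. (1 + \<epsilon> * a x) powr c) has_real_derivative c * a x) (at 0)"
      by (auto intro!: derivative_eq_intros)
  qed
qed

lemma flow_differentiable_exp:
  assumes a: "poly_bounded N a" and a0: "\<And>x. \<forall>l<N. 0 < x l \<Longrightarrow> 0 \<le> a x"
  shows "flow_differentiable N (\<lambda>\<epsilon> x. exp (- (\<epsilon> * a x))) (\<lambda>x. - a x)"
proof (rule flow_differentiableI)
  show "poly_bounded N (\<lambda>x. 1 + a x)" by (intro poly_bounded_intros a)
next
  fix \<epsilon> :: real
  show "(\<lambda>x. exp (- (\<epsilon> * a x))) \<in> borel_measurable (lborel_power N)" using a by measurable
next
  fix x :: "nat \<Rightarrow> real" and \<epsilon> :: real assume x: "\<forall>l<N. 0 < x l" and \<epsilon>: "\<epsilon> \<in> {0..1}"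
  have nn: "0 \<le> \<epsilon> * a x" using a0[OF x] \<epsilon> by simp
  then show "\<bar>exp (- (\<epsilon> * a x))\<bar> \<le> 1 + a x" using a0[OF x] by (simp add: order_trans[of _ 1])
  have "1 - \<epsilon> * a x \<le> exp (- (\<epsilon> * a x))" using exp_ge_add_one_self[of "- (\<epsilon> * a x)"] by simp
  moreover have "exp (- (\<epsilon> * a x)) \<le> 1" using nn by simp
  ultimately have "\<bar>exp (- (\<epsilon> * a x)) - 1\<bar> \<le> \<epsilon> * a x" by linarith
  then show "\<bar>exp (- (\<epsilon> * a x)) - exp (- (0 * a x))\<bar> \<le> \<epsilon> * (1 + a x)"
    using \<epsilon> unfolding distrib_left mult_zero_left minus_zero exp_zero by auto
next
  fix x :: "nat \<Rightarrow> real"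
  show "((\<lambda>\<epsilon>. exp (- (\<epsilon> * a x))) has_real_derivative - a x) (at 0)"
    by (auto intro!: derivative_eq_intros)
qed

text \<open>The integral is constant in the flow parameter, so the difference quotients along
  1/(n+1) all integrate to 0, and dominated convergence passes this on to the derivative. A sequence
  of positive parameters suffices, so the flow is never run backwards, where it would not preserve
  the half line.\<close>

lemma integral_flow_derivative_eq_0:
  assumes int: "integrable (lborel_power N) (laguerre_weight \<alpha>\<^sub>1 \<beta> N)"
    and u: "flow_differentiable N u d"
    and inv: "\<And>\<epsilon>. 0 < \<epsilon> \<Longrightarrow> \<epsilon> \<le> 1 \<Longrightarrow>
      (\<integral>x. laguerre_weight \<alpha>\<^sub>1 \<beta> N x * u \<epsilon> x \<partial>lborel_power N)
        = (\<integral>x. laguerre_weight \<alpha>\<^sub>1 \<beta> N x * u 0 x \<partial>lborel_power N)"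
  shows "(\<integral>x. laguerre_weight \<alpha>\<^sub>1 \<beta> N x * d x \<partial>lborel_power N) = 0"
proof -
  let ?w = "laguerre_weight \<alpha>\<^sub>1 \<beta> N" and ?L = "lborel_power N"
  obtain B where u: "\<And>\<epsilon>. \<epsilon> \<in> {0..1} \<Longrightarrow> u \<epsilon> \<in> borel_measurable ?L" "poly_bounded N B"
    "\<And>x \<epsilon>. \<forall>l<N. 0 < x l \<Longrightarrow> \<epsilon> \<in> {0..1} \<Longrightarrow> \<bar>u \<epsilon> x\<bar> \<le> B x"
    "\<And>x \<epsilon>. \<forall>l<N. 0 < x l \<Longrightarrow> \<epsilon> \<in> {0..1} \<Longrightarrow> \<bar>u \<epsilon> x - u 0 x\<bar> \<le> \<epsilon> * B x"
    "\<And>x. \<forall>l<N. 0 < x l \<Longrightarrow> ((\<lambda>\<epsilon>. u \<epsilon> x) has_real_derivative d x) (at 0)"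
    using u by (rule flow_differentiableE) (rule that)
  define e where "e n = 1 / real (Suc n)" for n
  have e: "0 < e n" "e n \<le> 1" "e n \<in> {0..1}" for n by (auto simp: e_def)
  have e0: "e \<longlonglongrightarrow> 0" unfolding e_def using LIMSEQ_inverse_real_of_nat by (simp add: inverse_eq_divide)
  define s where "s n x = ?w x * ((u (e n) x - u 0 x) / e n)" for n x
  have um: "u \<epsilon> \<in> borel_measurable ?L" if "\<epsilon> \<in> {0..1}" for \<epsilon> using u(1) that .
  have sm: "s n \<in> borel_measurable ?L" for n
    unfolding s_def using um[of "e n"] um[of 0] e[of n] by measurable
  have uint: "integrable ?L (\<lambda>x. ?w x * u \<epsilon> x)" if "\<epsilon> \<in> {0..1}" for \<epsilon>
  proof (rule integrable_laguerre_weight_mult[OF int])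
    show "poly_bounded N (u \<epsilon>)"
    proof (rule poly_bounded_mono[OF u(2) um[OF that]])
      fix x :: "nat \<Rightarrow> real" assume "\<forall>l<N. 0 < x l"
      then have "\<bar>u \<epsilon> x\<bar> \<le> B x" using that by (rule u(3))
      then show "\<bar>u \<epsilon> x\<bar> \<le> \<bar>B x\<bar>" by linarith
    qed
  qed
  have s0: "integral\<^sup>L ?L (s n) = 0" for n
  proof -
    have "integral\<^sup>L ?L (s n) = (\<integral>x. (?w x * u (e n) x - ?w x * u 0 x) / e n \<partial>?L)"
      unfolding s_def by (simp add: algebra_simps diff_divide_distrib)
    also have "\<dots> = ((\<integral>x. ?w x * u (e n) x \<partial>?L) - (\<integral>x. ?w x * u 0 x \<partial>?L)) / e n"
      using uint[of "e n"] uint[of 0] e[of n] by simp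
    finally show ?thesis using inv[OF e(1,2)] by simp
  qed
  have lim: "(\<lambda>n. s n x) \<longlonglongrightarrow> ?w x * d x" for x
  proof (cases "\<forall>l<N. 0 < x l")
    case True
    have "((\<lambda>h. (u (0 + h) x - u 0 x) / h) \<longlongrightarrow> d x) (at 0)"
      by (rule DERIV_D[OF u(5)[OF True]])
    moreover have "filterlim e (at 0) sequentially"
      using e0 e(1) by (auto simp: filterlim_at intro!: always_eventually) (metis less_irrefl)
    ultimately have "(\<lambda>n. (u (0 + e n) x - u 0 x) / e n) \<longlonglongrightarrow> d x"
      by (rule filterlim_compose)
    then show ?thesis unfolding s_def by (intro tendsto_mult tendsto_const) simp
  next
    case False
    then show ?thesis unfolding s_def by (simp only: laguerre_weight_eq_0[OF False] mult_zero_left tendsto_const)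
  qed
  have "(\<lambda>n. integral\<^sup>L ?L (s n)) \<longlonglongrightarrow> (\<integral>x. ?w x * d x \<partial>?L)"
  proof (rule integral_dominated_convergence)
    \<comment> \<open>Flow differentiability does not include measurability of \<open>d\<close>; it
      is recovered here from the difference quotients as a pointwise limit.\<close>
    show "(\<lambda>x. ?w x * d x) \<in> borel_measurable ?L"
      by (rule borel_measurable_LIMSEQ_real[OF _ sm]) (rule lim)
    show "integrable ?L (\<lambda>x. ?w x * B x)"
      by (rule integrable_laguerre_weight_mult[OF int u(2)])
    show "AE x in ?L. norm (s n x) \<le> ?w x * B x" for n
    proof (intro AE_I2)
      fix x :: "nat \<Rightarrow> real"
      show "norm (s n x) \<le> ?w x * B x"
      proof (cases "\<forall>l<N. 0 < x l")
        case True
        have "\<bar>(u (e n) x - u 0 x) / e n\<bar> \<le> B x"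
          using u(4)[OF True e(3)] e(1)[of n] by (simp add: field_simps)
        from mult_left_mono[OF this laguerre_weight_nonneg] show ?thesis
          unfolding s_def real_norm_def abs_mult abs_of_nonneg[OF laguerre_weight_nonneg] .
      next
        case False
        then show ?thesis unfolding s_def by (simp only: laguerre_weight_eq_0[OF False] mult_zero_left norm_zero)
      qed
    qed
  qed (use sm lim in auto)
  then show ?thesis unfolding s0 by (simp add: LIMSEQ_const_iff)
qed

section \<open>The loop equations\<close>

abbreviation power_stat :: "nat \<Rightarrow> nat \<Rightarrow> (nat \<Rightarrow> real) \<Rightarrow> real" where
  "power_stat N a \<equiv> linear_statistic N (\<lambda>t. t ^ a)"

definition power_flow :: "nat \<Rightarrow> real \<Rightarrow> real \<Rightarrow> real" where
  "power_flow p \<epsilon> t = t + \<epsilon> * t ^ (p + 1)"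

text \<open>This is the divided difference of t^(p+1), written as a polynomial so that it also makes
  sense on the diagonal s = t.\<close>

definition power_quotient :: "nat \<Rightarrow> real \<Rightarrow> real \<Rightarrow> real" where
  "power_quotient p s t = (\<Sum>i\<le>p. s ^ i * t ^ (p - i))"

text \<open>The Jacobian of the flow times the ratio of the transported weight to the original one,
  with x_l and x_k - x_j already cancelled. On the positive orthant and for \<epsilon> \<ge> 0 every
  base that remains is at least 1, so powers with negative exponents are harmless.\<close>

definition flow_factor :: "real \<Rightarrow> real \<Rightarrow> nat \<Rightarrow> nat \<Rightarrow> real \<Rightarrow> (nat \<Rightarrow> real) \<Rightarrow> real" where
  "flow_factor \<alpha>\<^sub>1 \<beta> p N \<epsilon> x =
     (\<Prod>l<N. (1 + \<epsilon> * x l ^ p) powr \<alpha>\<^sub>1 * exp (- (\<epsilon> * x l ^ (p + 1)))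
               * (1 + \<epsilon> * (real (p + 1) * x l ^ p)))
     * (\<Prod>k<N. \<Prod>j<k. (1 + \<epsilon> * power_quotient p (x j) (x k)) powr \<beta>)"

lemma power_quotient_nonneg: "0 \<le> s \<Longrightarrow> 0 \<le> t \<Longrightarrow> 0 \<le> power_quotient p s t"
  unfolding power_quotient_def by (intro sum_nonneg mult_nonneg_nonneg) auto

lemma power_flow_diff:
  "power_flow p \<epsilon> s - power_flow p \<epsilon> t = (s - t) * (1 + \<epsilon> * power_quotient p s t)"
proof -
  have "s ^ Suc p - t ^ Suc p = (s - t) * power_quotient p s t"
    unfolding power_quotient_def power_diff_sumr2 lessThan_Suc_atMost
    by (simp add: mult.commute)
  then have "\<epsilon> * s ^ (p + 1) - \<epsilon> * t ^ (p + 1) = (s - t) * (\<epsilon> * power_quotient p s t)"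
    by (simp add: right_diff_distrib[symmetric])
  then show ?thesis unfolding power_flow_def distrib_left by simp
qed

lemma half_line_map_power_flow:
  assumes "0 \<le> \<epsilon>"
  shows "half_line_map (power_flow p \<epsilon>) (\<lambda>t. 1 + \<epsilon> * (real (p + 1) * t ^ p))"
proof
  show "filterlim (power_flow p \<epsilon>) at_top at_top"
  proof (rule filterlim_at_top_mono[OF filterlim_ident])
    show "\<forall>\<^sub>F x in at_top. x \<le> power_flow p \<epsilon> x"
      using eventually_ge_at_top[of 0] by eventually_elim (use assms in \<open>auto simp: power_flow_def\<close>)
  qed
  show "power_flow p \<epsilon> \<in> borel_measurable borel" unfolding power_flow_def[abs_def] by measurable
  show "(power_flow p \<epsilon> has_real_derivative 1 + \<epsilon> * (real (p + 1) * x ^ p)) (at x)" for x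
    unfolding power_flow_def[abs_def] by (rule derivative_eq_intros refl | simp)+
qed (use assms in \<open>auto simp: power_flow_def intro!: continuous_intros\<close>)

lemma laguerre_weight_power_flow:
  assumes "0 \<le> \<epsilon>"
  shows "(\<Prod>i<N. (1 + \<epsilon> * (real (p + 1) * x i ^ p)) * indicator {0..} (x i))
      * laguerre_weight \<alpha>\<^sub>1 \<beta> N (\<lambda>i\<in>{..<N}. power_flow p \<epsilon> (x i))
    = laguerre_weight \<alpha>\<^sub>1 \<beta> N x * flow_factor \<alpha>\<^sub>1 \<beta> p N \<epsilon> x"
proof (cases "\<forall>l<N. 0 < x l")
  case True
  have pos: "0 < power_flow p \<epsilon> (x l)" if "l < N" for l
    using True that assms by (auto simp: power_flow_def intro!: add_pos_nonneg)
  have a: "power_flow p \<epsilon> (x l) powr \<alpha>\<^sub>1 * exp (- power_flow p \<epsilon> (x l))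
      = (x l powr \<alpha>\<^sub>1 * exp (- x l)) * ((1 + \<epsilon> * x l ^ p) powr \<alpha>\<^sub>1 * exp (- (\<epsilon> * x l ^ (p + 1))))"
    if "l < N" for l
  proof -
    have "power_flow p \<epsilon> (x l) = x l * (1 + \<epsilon> * x l ^ p)"
      by (simp add: power_flow_def algebra_simps)
    then have "power_flow p \<epsilon> (x l) powr \<alpha>\<^sub>1 = x l powr \<alpha>\<^sub>1 * (1 + \<epsilon> * x l ^ p) powr \<alpha>\<^sub>1"
      using True that assms by (simp add: powr_mult)
    moreover have "exp (- power_flow p \<epsilon> (x l)) = exp (- x l) * exp (- (\<epsilon> * x l ^ (p + 1)))"
      by (simp add: power_flow_def exp_add[symmetric])
    ultimately show ?thesis by (simp only: mult_ac)
  qed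
  have b: "\<bar>power_flow p \<epsilon> (x k) - power_flow p \<epsilon> (x j)\<bar> powr \<beta>
      = \<bar>x k - x j\<bar> powr \<beta> * (1 + \<epsilon> * power_quotient p (x j) (x k)) powr \<beta>" if "k < N" "j < k" for k j
  proof -
    have "0 \<le> power_quotient p (x j) (x k)"
      using True that by (intro power_quotient_nonneg) (auto intro: less_imp_le)
    then have q: "0 \<le> 1 + \<epsilon> * power_quotient p (x j) (x k)" using assms by simp
    have "\<bar>power_flow p \<epsilon> (x k) - power_flow p \<epsilon> (x j)\<bar>
        = \<bar>x k - x j\<bar> * (1 + \<epsilon> * power_quotient p (x j) (x k))"
      using q by (subst abs_minus_commute) (simp add: power_flow_diff abs_mult abs_minus_commute)
    then show ?thesis using q by (simp add: powr_mult)
  qed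
  have "laguerre_weight \<alpha>\<^sub>1 \<beta> N (\<lambda>i\<in>{..<N}. power_flow p \<epsilon> (x i))
    = (\<Prod>l<N. power_flow p \<epsilon> (x l) powr \<alpha>\<^sub>1 * exp (- power_flow p \<epsilon> (x l)))
      * (\<Prod>k<N. \<Prod>j<k. \<bar>power_flow p \<epsilon> (x k) - power_flow p \<epsilon> (x j)\<bar> powr \<beta>)"
    using pos by (auto simp: laguerre_weight_def intro!: prod.cong arg_cong2[of _ _ _ _ "(*)"])
  also have "(\<Prod>l<N. power_flow p \<epsilon> (x l) powr \<alpha>\<^sub>1 * exp (- power_flow p \<epsilon> (x l)))
      = (\<Prod>l<N. x l powr \<alpha>\<^sub>1 * exp (- x l))
        * (\<Prod>l<N. (1 + \<epsilon> * x l ^ p) powr \<alpha>\<^sub>1 * exp (- (\<epsilon> * x l ^ (p + 1))))"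
    unfolding prod.distrib[symmetric] by (intro prod.cong refl) (use a in auto)
  also have "(\<Prod>k<N. \<Prod>j<k. \<bar>power_flow p \<epsilon> (x k) - power_flow p \<epsilon> (x j)\<bar> powr \<beta>)
      = (\<Prod>k<N. \<Prod>j<k. \<bar>x k - x j\<bar> powr \<beta>)
        * (\<Prod>k<N. \<Prod>j<k. (1 + \<epsilon> * power_quotient p (x j) (x k)) powr \<beta>)"
    unfolding prod.distrib[symmetric] by (intro prod.cong refl) (use b in auto)
  finally have 1: "laguerre_weight \<alpha>\<^sub>1 \<beta> N (\<lambda>i\<in>{..<N}. power_flow p \<epsilon> (x i))
    = ((\<Prod>l<N. x l powr \<alpha>\<^sub>1 * exp (- x l))
        * (\<Prod>l<N. (1 + \<epsilon> * x l ^ p) powr \<alpha>\<^sub>1 * exp (- (\<epsilon> * x l ^ (p + 1)))))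
      * ((\<Prod>k<N. \<Prod>j<k. \<bar>x k - x j\<bar> powr \<beta>)
        * (\<Prod>k<N. \<Prod>j<k. (1 + \<epsilon> * power_quotient p (x j) (x k)) powr \<beta>))" .
  have 2: "laguerre_weight \<alpha>\<^sub>1 \<beta> N x
      = (\<Prod>l<N. x l powr \<alpha>\<^sub>1 * exp (- x l)) * (\<Prod>k<N. \<Prod>j<k. \<bar>x k - x j\<bar> powr \<beta>)"
    unfolding laguerre_weight_def by (rule if_P[OF True])
  have 3: "(\<Prod>i<N. (1 + \<epsilon> * (real (p + 1) * x i ^ p)) * indicator {0..} (x i))
      = (\<Prod>i<N. 1 + \<epsilon> * (real (p + 1) * x i ^ p))"
    using True by (intro prod.cong refl) (auto simp: indicator_def)
  have 4: "flow_factor \<alpha>\<^sub>1 \<beta> p N \<epsilon> x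
      = ((\<Prod>l<N. (1 + \<epsilon> * x l ^ p) powr \<alpha>\<^sub>1 * exp (- (\<epsilon> * x l ^ (p + 1))))
        * (\<Prod>l<N. 1 + \<epsilon> * (real (p + 1) * x l ^ p)))
        * (\<Prod>k<N. \<Prod>j<k. (1 + \<epsilon> * power_quotient p (x j) (x k)) powr \<beta>)"
    by (simp only: flow_factor_def prod.distrib)
  have rearrange: "e * ((a * b) * (c * d)) = (a * c) * ((b * e) * d)" for a b c d e :: real by simp
  show ?thesis unfolding 1 2 3 4 by (rule rearrange)
next
  case False
  then obtain l where l: "l < N" "x l \<le> 0" by (auto simp: not_less)
  show ?thesis
  \<comment> \<open>The two ways of leaving the open orthant vanish for different reasons. At 0 the
    indicator is 1, but the flow fixes 0, so the transported weight is 0. At a negative coordinate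
    the flow may well land in the positive axis, and it is the indicator that vanishes.\<close>
  proof (cases "x l = 0")
    case True
    then have "\<not> (\<forall>l<N. 0 < (\<lambda>i\<in>{..<N}. power_flow p \<epsilon> (x i)) l)"
      using l by (auto simp: power_flow_def intro!: exI[of _ l])
    note zero = laguerre_weight_eq_0[OF this]
    show ?thesis
      by (simp only: zero laguerre_weight_eq_0[OF False] mult_zero_left mult_zero_right)
  next
    case neg: False
    then have "(\<Prod>i<N. (1 + \<epsilon> * (real (p + 1) * x i ^ p)) * indicator {0..} (x i)) = 0"
      using l by (intro prod_zero) (auto intro!: bexI[of _ l])
    then show ?thesis by (simp only: laguerre_weight_eq_0[OF False] mult_zero_left mult_zero_right)
  qed
qed

lemma integral_laguerre_weight_power_flow:
  assumes "0 \<le> \<epsilon>" and G[measurable]: "G \<in> borel_measurable (lborel_power N)"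
  shows "(\<integral>x. laguerre_weight \<alpha>\<^sub>1 \<beta> N x * G x \<partial>lborel_power N)
    = (\<integral>x. laguerre_weight \<alpha>\<^sub>1 \<beta> N x
        * (flow_factor \<alpha>\<^sub>1 \<beta> p N \<epsilon> x * G (\<lambda>i\<in>{..<N}. power_flow p \<epsilon> (x i))) \<partial>lborel_power N)"
proof -
  interpret half_line_map "power_flow p \<epsilon>" "\<lambda>t. 1 + \<epsilon> * (real (p + 1) * t ^ p)"
    by (rule half_line_map_power_flow[OF assms(1)])
  have "(\<integral>x. laguerre_weight \<alpha>\<^sub>1 \<beta> N x * G x \<partial>lborel_power N)
    = (\<integral>x. (\<Prod>i<N. (1 + \<epsilon> * (real (p + 1) * x i ^ p)) * indicator {0..} (x i))
        * (laguerre_weight \<alpha>\<^sub>1 \<beta> N (\<lambda>i\<in>{..<N}. power_flow p \<epsilon> (x i))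
          * G (\<lambda>i\<in>{..<N}. power_flow p \<epsilon> (x i))) \<partial>lborel_power N)"
  proof (rule PiM_lborel_substitution(2))
    fix x :: "nat \<Rightarrow> real" and i assume "i \<in> {..<N}" "x i < 0"
    then have "\<not> (\<forall>l<N. 0 < x l)" by (auto simp: not_less intro!: exI[of _ i])
    then have "laguerre_weight \<alpha>\<^sub>1 \<beta> N x = 0" by (rule laguerre_weight_eq_0)
    then show "laguerre_weight \<alpha>\<^sub>1 \<beta> N x * G x = 0" by simp
  qed auto
  also have "\<dots> = (\<integral>x. laguerre_weight \<alpha>\<^sub>1 \<beta> N x
      * (flow_factor \<alpha>\<^sub>1 \<beta> p N \<epsilon> x * G (\<lambda>i\<in>{..<N}. power_flow p \<epsilon> (x i))) \<partial>lborel_power N)"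
    by (rule Bochner_Integration.integral_cong[OF refl], subst mult.assoc[symmetric],
        subst laguerre_weight_power_flow[OF assms(1)], rule mult.assoc)
  finally show ?thesis .
qed

section \<open>Derivative of the flow factor in terms of power sums\<close>

lemma sum_symmetric_half:
  fixes f :: "nat \<Rightarrow> nat \<Rightarrow> real"
  assumes "\<And>i j. f i j = f j i"
  shows "2 * (\<Sum>k<N. \<Sum>j<k. f j k) = (\<Sum>k<N. \<Sum>j<N. f j k) - (\<Sum>k<N. f k k)"
proof (induction N)
  case (Suc N)
  have "(\<Sum>j<N. f N j) = (\<Sum>j<N. f j N)" using assms by (intro sum.cong) auto
  with Suc show ?case by (simp add: sum.distrib distrib_left)
qed simp

text \<open>The unrestricted double sum factorises into products of power sums. Passing to pairs j <
  k removes the diagonal, where the divided difference is (p+1) x^p; this is the origin of the 1/N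
  correction in the coefficient of the loop equation.\<close>

lemma sum_power_quotient:
  "2 * (\<Sum>k<N. \<Sum>j<k. power_quotient p (x j) (x k))
    = (\<Sum>s\<le>p. power_stat N s x * power_stat N (p - s) x) - real (p + 1) * power_stat N p x"
proof -
  have sym: "power_quotient p s t = power_quotient p t s" for s t
    unfolding power_quotient_def
    by (rule sum.reindex_bij_witness[of _ "\<lambda>i. p - i" "\<lambda>i. p - i"]) auto
  have diag: "power_quotient p t t = real (p + 1) * t ^ p" for t
  proof -
    have "power_quotient p t t = (\<Sum>i\<le>p. t ^ p)"
      unfolding power_quotient_def by (intro sum.cong) (auto simp: power_add[symmetric])
    then show ?thesis by simp
  qed
  have "(\<Sum>k<N. \<Sum>j<N. power_quotient p (x j) (x k))
      = (\<Sum>s\<le>p. \<Sum>k<N. \<Sum>j<N. x j ^ s * x k ^ (p - s))"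
    unfolding power_quotient_def
    by (simp only: sum.swap[of _ "{..<N}" "{..p}"])
  also have "\<dots> = (\<Sum>s\<le>p. power_stat N s x * power_stat N (p - s) x)"
    by (simp add: linear_statistic_def sum_product) (intro sum.cong refl sum.swap)
  finally show ?thesis
    using sum_symmetric_half[of "\<lambda>j k. power_quotient p (x j) (x k)" N] sym
    by (simp add: diag linear_statistic_def sum_distrib_left)
qed

text \<open>The four sources are visible in the result: \<alpha>_1 from the power, the negative
  power sum from the exponential, p + 1 from the Jacobian, and \<beta>/2 from the Vandermonde factor
  after symmetrisation.\<close>

lemma flow_differentiable_factor:
  "flow_differentiable N (flow_factor \<alpha>\<^sub>1 \<beta> p N)
    (\<lambda>x. (real p + 1 + \<alpha>\<^sub>1) * power_stat N p x - power_stat N (p + 1) x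
      + \<beta> / 2 * ((\<Sum>s\<le>p. power_stat N s x * power_stat N (p - s) x) - real (p + 1) * power_stat N p x))"
proof -
  have pb: "poly_bounded N (\<lambda>x. x l ^ q)" if "l < N" for l q
    using that by (intro poly_bounded_intros)
  have one: "flow_differentiable N
      (\<lambda>\<epsilon> x. (1 + \<epsilon> * x l ^ p) powr \<alpha>\<^sub>1 * exp (- (\<epsilon> * x l ^ (p + 1))) * (1 + \<epsilon> * (real (p + 1) * x l ^ p)))
      (\<lambda>x. \<alpha>\<^sub>1 * x l ^ p - x l ^ (p + 1) + real (p + 1) * x l ^ p)" if l: "l < N" for l
  proof -
    have "flow_differentiable N
      (\<lambda>\<epsilon> x. (1 + \<epsilon> * x l ^ p) powr \<alpha>\<^sub>1 * exp (- (\<epsilon> * x l ^ (p + 1))) * (1 + \<epsilon> * (real (p + 1) * x l ^ p)))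
      (\<lambda>x. (\<alpha>\<^sub>1 * x l ^ p * exp (- (0 * x l ^ (p + 1))) + (1 + 0 * x l ^ p) powr \<alpha>\<^sub>1 * (- (x l ^ (p + 1))))
          * (1 + 0 * (real (p + 1) * x l ^ p))
        + (1 + 0 * x l ^ p) powr \<alpha>\<^sub>1 * exp (- (0 * x l ^ (p + 1))) * (0 + real (p + 1) * x l ^ p))"
      using l by (intro flow_differentiable_mult flow_differentiable_powr flow_differentiable_exp
          flow_differentiable_add flow_differentiable_linear flow_differentiable_const
          poly_bounded_intros pb) (auto intro: less_imp_le)
    then show ?thesis by (rule flow_differentiable_cong) simp
  qed
  have two: "flow_differentiable N (\<lambda>\<epsilon> x. (1 + \<epsilon> * power_quotient p (x j) (x k)) powr \<beta>)
      (\<lambda>x. \<beta> * power_quotient p (x j) (x k))" if "j < k" "k < N" for j k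
  proof (rule flow_differentiable_powr)
    show "poly_bounded N (\<lambda>x. power_quotient p (x j) (x k))"
      unfolding power_quotient_def using that by (intro poly_bounded_intros) auto
    show "0 \<le> power_quotient p (x j) (x k)" if "\<forall>l<N. 0 < x l" for x
      using that \<open>j < k\<close> \<open>k < N\<close> by (intro power_quotient_nonneg) (auto intro: less_imp_le)
  qed
  have "flow_differentiable N (flow_factor \<alpha>\<^sub>1 \<beta> p N)
    (\<lambda>x. (\<Sum>l<N. \<alpha>\<^sub>1 * x l ^ p - x l ^ (p + 1) + real (p + 1) * x l ^ p)
          * (\<Prod>k<N. \<Prod>j<k. (1 + 0 * power_quotient p (x j) (x k)) powr \<beta>)
      + (\<Prod>l<N. (1 + 0 * x l ^ p) powr \<alpha>\<^sub>1 * exp (- (0 * x l ^ (p + 1))) * (1 + 0 * (real (p + 1) * x l ^ p)))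
          * (\<Sum>k<N. \<Sum>j<k. \<beta> * power_quotient p (x j) (x k)))"
    unfolding flow_factor_def[abs_def]
    by (intro flow_differentiable_mult flow_differentiable_prod one two) auto
  then show ?thesis
  proof (rule flow_differentiable_cong)
    fix x :: "nat \<Rightarrow> real"
    have "(\<Sum>l<N. \<alpha>\<^sub>1 * x l ^ p - x l ^ (p + 1) + real (p + 1) * x l ^ p)
        = (real p + 1 + \<alpha>\<^sub>1) * power_stat N p x - power_stat N (p + 1) x"
      by (simp add: linear_statistic_def sum.distrib sum_subtractf sum_distrib_left[symmetric] algebra_simps)
    moreover have "(\<Sum>k<N. \<Sum>j<k. \<beta> * power_quotient p (x j) (x k))
        = \<beta> / 2 * ((\<Sum>s\<le>p. power_stat N s x * power_stat N (p - s) x) - real (p + 1) * power_stat N p x)"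
      unfolding sum_power_quotient[symmetric] by (simp add: sum_distrib_left)
    ultimately show "(\<Sum>l<N. \<alpha>\<^sub>1 * x l ^ p - x l ^ (p + 1) + real (p + 1) * x l ^ p)
          * (\<Prod>k<N. \<Prod>j<k. (1 + 0 * power_quotient p (x j) (x k)) powr \<beta>)
      + (\<Prod>l<N. (1 + 0 * x l ^ p) powr \<alpha>\<^sub>1 * exp (- (0 * x l ^ (p + 1))) * (1 + 0 * (real (p + 1) * x l ^ p)))
          * (\<Sum>k<N. \<Sum>j<k. \<beta> * power_quotient p (x j) (x k))
      = (real p + 1 + \<alpha>\<^sub>1) * power_stat N p x - power_stat N (p + 1) x
      + \<beta> / 2 * ((\<Sum>s\<le>p. power_stat N s x * power_stat N (p - s) x) - real (p + 1) * power_stat N p x)"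
      by simp
  qed
qed

lemma flow_differentiable_power_stat:
  "flow_differentiable N (\<lambda>\<epsilon> x. power_stat N a (\<lambda>i\<in>{..<N}. power_flow p \<epsilon> (x i)))
    (\<lambda>x. real a * power_stat N (p + a) x)"
proof -
  have "flow_differentiable N (\<lambda>\<epsilon> x. \<Sum>i<N. (x i + \<epsilon> * x i ^ (p + 1)) ^ a)
    (\<lambda>x. \<Sum>i<N. real a * (x i + 0 * x i ^ (p + 1)) ^ (a - 1) * (0 + x i ^ (p + 1)))"
    by (intro flow_differentiable_sum flow_differentiable_power flow_differentiable_add
        flow_differentiable_const flow_differentiable_linear poly_bounded_intros) auto
  then have "flow_differentiable N (\<lambda>\<epsilon> x. \<Sum>i<N. (x i + \<epsilon> * x i ^ (p + 1)) ^ a)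
    (\<lambda>x. real a * power_stat N (p + a) x)"
  proof (rule flow_differentiable_cong)
    fix x :: "nat \<Rightarrow> real"
    have eq: "real a * (y + 0 * y ^ (p + 1)) ^ (a - 1) * (0 + y ^ (p + 1)) = real a * y ^ (p + a)"
      for y :: real
      \<comment> \<open>For a = 0 the exponent \<open>a - 1\<close> is truncated to 0, which does no
        harm since the factor \<open>real a\<close> vanishes.\<close>
      by (cases a) (simp_all add: power_add)
    show "(\<Sum>i<N. real a * (x i + 0 * x i ^ (p + 1)) ^ (a - 1) * (0 + x i ^ (p + 1)))
        = real a * power_stat N (p + a) x"
      unfolding linear_statistic_def sum_distrib_left eq ..
  qed
  then show ?thesis by (simp add: linear_statistic_def power_flow_def)
qed

text \<open>The shifts \<open>c\<close> are arbitrary constants, unaffected by the flow; later they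
  become the means. The first term under the integral differentiates the weight together with the
  Jacobian, the second the test function.\<close>

lemma loop_equation_weight:
  fixes M :: "nat multiset" and c :: "nat \<Rightarrow> real"
  assumes int: "integrable (lborel_power N) (laguerre_weight \<alpha>\<^sub>1 \<beta> N)"
  shows "(\<integral>x. laguerre_weight \<alpha>\<^sub>1 \<beta> N x *
     (((real p + 1 + \<alpha>\<^sub>1) * power_stat N p x - power_stat N (p + 1) x
      + \<beta> / 2 * ((\<Sum>s\<le>p. power_stat N s x * power_stat N (p - s) x) - real (p + 1) * power_stat N p x))
        * (\<Prod>a\<in>#M. power_stat N a x - c a)
      + (\<Sum>b\<in>#M. real b * power_stat N (p + b) x * (\<Prod>a\<in>#M - {#b#}. power_stat N a x - c a)))
    \<partial>lborel_power N) = 0"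
proof -
  define G where "G x = (\<Prod>a\<in>#M. power_stat N a x - c a)" for x
  have G: "G \<in> borel_measurable (lborel_power N)"
    unfolding G_def[abs_def] by (intro poly_bounded_measurable poly_bounded_intros)
  let ?T = "\<lambda>\<epsilon> x. \<lambda>i\<in>{..<N}. power_flow p \<epsilon> (x i)"
  have T0: "power_stat N a (?T 0 x) = power_stat N a x" for a x
    by (simp add: linear_statistic_def power_flow_def)
  have F0: "flow_factor \<alpha>\<^sub>1 \<beta> p N 0 x = 1" for x by (simp add: flow_factor_def)
  have "flow_differentiable N (\<lambda>\<epsilon> x. \<Prod>a\<in>#M. power_stat N a (?T \<epsilon> x) + - c a)
    (\<lambda>x. \<Sum>b\<in>#M. (real b * power_stat N (p + b) x + 0) * (\<Prod>a\<in>#M - {#b#}. power_stat N a (?T 0 x) + - c a))"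
    by (intro flow_differentiable_prod_mset flow_differentiable_add flow_differentiable_power_stat
        flow_differentiable_const poly_bounded_intros)
  then have "flow_differentiable N (\<lambda>\<epsilon> x. G (?T \<epsilon> x))
    (\<lambda>x. \<Sum>b\<in>#M. real b * power_stat N (p + b) x * (\<Prod>a\<in>#M - {#b#}. power_stat N a x - c a))"
    by (simp add: G_def T0)
  from flow_differentiable_mult[OF flow_differentiable_factor[of N \<alpha>\<^sub>1 \<beta> p] this]
  have diff: "flow_differentiable N (\<lambda>\<epsilon> x. flow_factor \<alpha>\<^sub>1 \<beta> p N \<epsilon> x * G (?T \<epsilon> x))
    (\<lambda>x. ((real p + 1 + \<alpha>\<^sub>1) * power_stat N p x - power_stat N (p + 1) x
      + \<beta> / 2 * ((\<Sum>s\<le>p. power_stat N s x * power_stat N (p - s) x) - real (p + 1) * power_stat N p x))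
        * (\<Prod>a\<in>#M. power_stat N a x - c a)
      + (\<Sum>b\<in>#M. real b * power_stat N (p + b) x * (\<Prod>a\<in>#M - {#b#}. power_stat N a x - c a)))"
    by (simp only: F0 mult_1 G_def T0)
  show ?thesis
  proof (rule integral_flow_derivative_eq_0[OF int diff])
    fix \<epsilon> :: real assume "0 < \<epsilon>" "\<epsilon> \<le> 1"
    then show "(\<integral>x. laguerre_weight \<alpha>\<^sub>1 \<beta> N x * (flow_factor \<alpha>\<^sub>1 \<beta> p N \<epsilon> x * G (?T \<epsilon> x)) \<partial>lborel_power N)
        = (\<integral>x. laguerre_weight \<alpha>\<^sub>1 \<beta> N x * (flow_factor \<alpha>\<^sub>1 \<beta> p N 0 x * G (?T 0 x)) \<partial>lborel_power N)"
      \<comment> \<open>Invariance at \<epsilon> and at 0 is used: both sides equal the integral of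
        the weight times \<open>G\<close>.\<close>
      using integral_laguerre_weight_power_flow[OF _ G, of \<epsilon> \<alpha>\<^sub>1 \<beta> p]
        integral_laguerre_weight_power_flow[OF _ G, of 0 \<alpha>\<^sub>1 \<beta> p] by simp
  qed
qed

section \<open>Centered moments\<close>

lemma laguerre_partition_function_nonneg: "0 \<le> laguerre_partition_function \<alpha>\<^sub>1 \<beta> N"
  unfolding laguerre_partition_function_def by (intro Bochner_Integration.integral_nonneg) (simp add: laguerre_weight_nonneg)

text \<open>The integral of a non-integrable function has the default value 0, so a nonzero
  partition function certifies integrability.\<close>

lemma integrable_laguerre_weight:
  "laguerre_partition_function \<alpha>\<^sub>1 \<beta> N \<noteq> 0 \<Longrightarrow> integrable (lborel_power N) (laguerre_weight \<alpha>\<^sub>1 \<beta> N)"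
  unfolding laguerre_partition_function_def using not_integrable_integral_eq by blast

text \<open>A zero partition function is allowed: division by zero then makes the density and the
  right-hand side both 0. This serves the degenerate case of the limit.\<close>

lemma integral_laguerre_ensemble:
  assumes "poly_bounded N f"
  shows "(\<integral>x. f x \<partial>laguerre_ensemble \<alpha>\<^sub>1 \<beta> N)
    = (\<integral>x. laguerre_weight \<alpha>\<^sub>1 \<beta> N x * f x \<partial>lborel_power N) / laguerre_partition_function \<alpha>\<^sub>1 \<beta> N"
  unfolding laguerre_ensemble_def using assms
  by (subst integral_density)
    (auto simp: laguerre_weight_nonneg laguerre_partition_function_nonneg poly_bounded_def)

lemma integrable_laguerre_ensemble:
  assumes "laguerre_partition_function \<alpha>\<^sub>1 \<beta> N \<noteq> 0" "poly_bounded N f"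
  shows "integrable (laguerre_ensemble \<alpha>\<^sub>1 \<beta> N) f"
proof -
  have "integrable (lborel_power N) (\<lambda>x. laguerre_weight \<alpha>\<^sub>1 \<beta> N x * f x / laguerre_partition_function \<alpha>\<^sub>1 \<beta> N)"
    using integrable_laguerre_weight_mult[OF integrable_laguerre_weight[OF assms(1)] assms(2)] by simp
  then show ?thesis
    unfolding laguerre_ensemble_def using assms
    by (subst integrable_density)
      (auto simp: laguerre_weight_nonneg laguerre_partition_function_nonneg poly_bounded_def)
qed

lemma integral_laguerre_ensemble_const:
  assumes "laguerre_partition_function \<alpha>\<^sub>1 \<beta> N \<noteq> 0"
  shows "(\<integral>x. (c::real) \<partial>laguerre_ensemble \<alpha>\<^sub>1 \<beta> N) = c"
  using assms by (subst integral_laguerre_ensemble[OF poly_bounded_const])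
    (simp add: laguerre_partition_function_def)

definition mean_stat :: "real \<Rightarrow> real \<Rightarrow> nat \<Rightarrow> nat \<Rightarrow> real" where
  "mean_stat \<alpha>\<^sub>1 \<alpha> N a = (\<integral>x. power_stat N a x / real N \<partial>high_temp_ensemble \<alpha>\<^sub>1 \<alpha> N)"

definition centered_stat :: "real \<Rightarrow> real \<Rightarrow> nat \<Rightarrow> nat \<Rightarrow> (nat \<Rightarrow> real) \<Rightarrow> real" where
  "centered_stat \<alpha>\<^sub>1 \<alpha> N a x = power_stat N a x / real N - mean_stat \<alpha>\<^sub>1 \<alpha> N a"

definition centered_moment :: "real \<Rightarrow> real \<Rightarrow> nat \<Rightarrow> nat multiset \<Rightarrow> real" where
  "centered_moment \<alpha>\<^sub>1 \<alpha> N M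
    = (\<integral>x. (\<Prod>a\<in>#M. centered_stat \<alpha>\<^sub>1 \<alpha> N a x) \<partial>high_temp_ensemble \<alpha>\<^sub>1 \<alpha> N)"

lemma poly_bounded_power_stat_div: "poly_bounded N (\<lambda>x. power_stat N a x / real N)"
  using poly_bounded_mult[OF poly_bounded_const poly_bounded_linear_statistic, of N "1 / real N" a] by simp

lemma poly_bounded_centered_stat: "poly_bounded N (centered_stat \<alpha>\<^sub>1 \<alpha> N a)"
  unfolding centered_stat_def[abs_def] by (intro poly_bounded_intros poly_bounded_power_stat_div)

locale laguerre_nondegenerate =
  fixes \<alpha>\<^sub>1 \<alpha> :: real and N :: nat
  assumes N: "0 < N" and Z: "laguerre_partition_function \<alpha>\<^sub>1 (2 * \<alpha> / real N) N \<noteq> 0"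
begin

abbreviation E :: "((nat \<Rightarrow> real) \<Rightarrow> real) \<Rightarrow> real" where
  "E f \<equiv> integral\<^sup>L (high_temp_ensemble \<alpha>\<^sub>1 \<alpha> N) f"

abbreviation "p \<equiv> \<lambda>a x. power_stat N a x / real N"
abbreviation "m \<equiv> mean_stat \<alpha>\<^sub>1 \<alpha> N"
abbreviation "Y \<equiv> centered_stat \<alpha>\<^sub>1 \<alpha> N"
abbreviation "\<kappa> \<equiv> centered_moment \<alpha>\<^sub>1 \<alpha> N"
abbreviation "\<Pi>Y \<equiv> \<lambda>M x. \<Prod>a\<in>#M. Y a x"

lemmas pb = poly_bounded_intros poly_bounded_centered_stat poly_bounded_power_stat_div

lemma integrable: "poly_bounded N f \<Longrightarrow> integrable (high_temp_ensemble \<alpha>\<^sub>1 \<alpha> N) f"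
  by (rule integrable_laguerre_ensemble[OF Z])

lemma E_const: "E (\<lambda>_. c) = c"
  by (rule integral_laguerre_ensemble_const[OF Z])

lemma measure_space_eq_1: "measure (high_temp_ensemble \<alpha>\<^sub>1 \<alpha> N) (space (high_temp_ensemble \<alpha>\<^sub>1 \<alpha> N)) = 1"
  using E_const[of 1] by simp

lemma p_eq: "p a x = Y a x + m a"
  by (simp add: centered_stat_def)

lemma moment_empty: "\<kappa> {#} = 1"
  by (simp add: centered_moment_def measure_space_eq_1)

lemma moment_single: "\<kappa> {#a#} = 0"
  using integrable[OF poly_bounded_power_stat_div, of a] integrable[OF poly_bounded_const, of "m a"]
  by (simp add: centered_moment_def centered_stat_def measure_space_eq_1) (simp add: mean_stat_def)

lemma mean_0: "m 0 = 1"
  using N by (simp add: mean_stat_def linear_statistic_def measure_space_eq_1)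

text \<open>The power sum of exponent 0 is the constant N, so its centered version is identically 0.
  Hence the boundary terms s = 0 and s = r of the recursion need no separate treatment.\<close>

lemma moment_0: "0 \<in># M \<Longrightarrow> \<kappa> M = 0"
proof -
  have "Y 0 x = 0" for x
    using N by (simp add: centered_stat_def mean_0) (simp add: linear_statistic_def)
  moreover assume "0 \<in># M"
  then obtain M' where "M = add_mset 0 M'" by (metis multi_member_split)
  ultimately show ?thesis by (simp add: centered_moment_def)
qed

lemma E_mult: "E (\<lambda>x. p a x * \<Pi>Y M x) = \<kappa> (add_mset a M) + m a * \<kappa> M"
proof -
  have "E (\<lambda>x. p a x * \<Pi>Y M x) = E (\<lambda>x. Y a x * \<Pi>Y M x + m a * \<Pi>Y M x)"
    by (simp only: p_eq distrib_right)
  also have "\<dots> = E (\<lambda>x. Y a x * \<Pi>Y M x) + E (\<lambda>x. m a * \<Pi>Y M x)"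
    by (intro Bochner_Integration.integral_add integrable pb)
  finally show ?thesis by (simp add: centered_moment_def)
qed

lemma E_mult2: "E (\<lambda>x. p a x * p b x * \<Pi>Y M x)
    = \<kappa> (add_mset a (add_mset b M)) + m a * \<kappa> (add_mset b M) + m b * \<kappa> (add_mset a M) + m a * m b * \<kappa> M"
proof -
  have "E (\<lambda>x. p a x * p b x * \<Pi>Y M x)
      = E (\<lambda>x. p a x * \<Pi>Y (add_mset b M) x + m b * (p a x * \<Pi>Y M x))"
    by (intro Bochner_Integration.integral_cong refl) (simp add: p_eq[of b] algebra_simps)
  also have "\<dots> = E (\<lambda>x. p a x * \<Pi>Y (add_mset b M) x) + E (\<lambda>x. m b * (p a x * \<Pi>Y M x))"
    by (intro Bochner_Integration.integral_add integrable pb)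
  also have "E (\<lambda>x. m b * (p a x * \<Pi>Y M x)) = m b * E (\<lambda>x. p a x * \<Pi>Y M x)"
    by simp
  finally show ?thesis unfolding E_mult by (simp add: algebra_simps)
qed

lemma E_sum_mset:
  assumes "\<And>b. b \<in># M \<Longrightarrow> poly_bounded N (f b)"
  shows "E (\<lambda>x. \<Sum>b\<in>#M. f b x) = (\<Sum>b\<in>#M. E (f b))"
  using assms
proof (induction M)
  case (add b M)
  have "E (\<lambda>x. f b x + (\<Sum>b\<in>#M. f b x)) = E (f b) + E (\<lambda>x. \<Sum>b\<in>#M. f b x)"
    using add.prems by (intro Bochner_Integration.integral_add integrable pb) auto
  with add show ?case by simp
qed simp

text \<open>The identity is a count of powers of N. Every power sum carries one N; in the quadratic
  term one of its two is absorbed by \<beta>/2 = \<alpha>/N. Differentiating a test factor replaces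
  it by a single power sum and leaves no further factor N, whence the prefactor 1/N of the last
  sum.\<close>

lemma loop_equation:
  "E (\<lambda>x. p (r + 1) x * \<Pi>Y M x)
    = (real r + 1 + \<alpha>\<^sub>1 - \<alpha> * (real r + 1) / real N) * E (\<lambda>x. p r x * \<Pi>Y M x)
      + \<alpha> * (\<Sum>s\<le>r. E (\<lambda>x. p s x * p (r - s) x * \<Pi>Y M x))
      + 1 / real N * (\<Sum>b\<in>#M. real b * E (\<lambda>x. p (r + b) x * \<Pi>Y (M - {#b#}) x))"
proof -
  define A where "A = real r + 1 + \<alpha>\<^sub>1 - \<alpha> * (real r + 1) / real N"
  define h where "h x = A * (p r x * \<Pi>Y M x) + - 1 * (p (r + 1) x * \<Pi>Y M x)
      + \<alpha> * (\<Sum>s\<le>r. p s x * p (r - s) x * \<Pi>Y M x)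
      + 1 / real N * (\<Sum>b\<in>#M. real b * (p (r + b) x * \<Pi>Y (M - {#b#}) x))" for x
  have N0: "real N \<noteq> 0" using N by simp
  have P: "power_stat N a x = real N * p a x" for a x using N0 by simp
  have prod_P: "(\<Prod>a\<in>#M. power_stat N a x - real N * m a) = real N ^ size M * \<Pi>Y M x" for M x
  proof (induction M)
    case (add a M)
    have "power_stat N a x - real N * m a = real N * Y a x"
      using N0 by (simp add: centered_stat_def field_simps)
    with add show ?case by simp
  qed simp
  have sum_P: "(\<Sum>b\<in>#M. real b * power_stat N (r + b) x * (\<Prod>a\<in>#M - {#b#}. power_stat N a x - real N * m a))
      = real N ^ size M * (\<Sum>b\<in>#M. real b * (p (r + b) x * \<Pi>Y (M - {#b#}) x))" for x
    unfolding sum_mset_distrib_left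
  proof (intro arg_cong[where f = sum_mset] image_mset_cong)
    fix b assume "b \<in># M"
    then have "size M = Suc (size (M - {#b#}))" by (metis insert_DiffM size_add_mset)
    then have "real N ^ size M = real N * real N ^ size (M - {#b#})" by simp
    then show "real b * power_stat N (r + b) x * (\<Prod>a\<in>#M - {#b#}. power_stat N a x - real N * m a)
        = real N ^ size M * (real b * (p (r + b) x * \<Pi>Y (M - {#b#}) x))"
      unfolding prod_P using N0 by simp
  qed
  have key: "((real r + 1 + \<alpha>\<^sub>1) * power_stat N r x - power_stat N (r + 1) x
      + (2 * \<alpha> / real N) / 2 * ((\<Sum>s\<le>r. power_stat N s x * power_stat N (r - s) x) - real (r + 1) * power_stat N r x))
        * (\<Prod>a\<in>#M. power_stat N a x - real N * m a)
      + (\<Sum>b\<in>#M. real b * power_stat N (r + b) x * (\<Prod>a\<in>#M - {#b#}. power_stat N a x - real N * m a))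
      = real N ^ (size M + 1) * h x" for x
  proof -
    have S: "(\<Sum>s\<le>r. power_stat N s x * power_stat N (r - s) x) = real N ^ 2 * (\<Sum>s\<le>r. p s x * p (r - s) x)"
      unfolding sum_distrib_left using N0 by (intro sum.cong refl) (simp add: power2_eq_square)
    have gen: "((real r + 1 + \<alpha>\<^sub>1) * P' - Q'
      + (2 * \<alpha> / real N) / 2 * (S' - real (r + 1) * P')) * F' + T'
      = real N ^ (size M + 1) * (A * (P * F) + - 1 * (Q * F) + \<alpha> * (S * F) + 1 / real N * T)"
      if "P' = real N * P" "Q' = real N * Q" "S' = real N ^ 2 * S" "F' = real N ^ size M * F"
        "T' = real N ^ size M * T" for P Q S F T P' Q' S' F' T'
      unfolding that using N0 by (simp add: A_def field_simps power2_eq_square)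
    show ?thesis
      unfolding h_def sum_distrib_right[symmetric] by (rule gen[OF P P S prod_P sum_P])
  qed
  have hp: "poly_bounded N h" unfolding h_def[abs_def] by (intro pb)
  have "(\<integral>x. laguerre_weight \<alpha>\<^sub>1 (2 * \<alpha> / real N) N x * (real N ^ (size M + 1) * h x) \<partial>lborel_power N) = 0"
    using loop_equation_weight[OF integrable_laguerre_weight[OF Z], where p = r and M = M and c = "\<lambda>a. real N * m a"]
    by (simp only: key)
  also have "(\<integral>x. laguerre_weight \<alpha>\<^sub>1 (2 * \<alpha> / real N) N x * (real N ^ (size M + 1) * h x) \<partial>lborel_power N)
      = real N ^ (size M + 1) * (\<integral>x. laguerre_weight \<alpha>\<^sub>1 (2 * \<alpha> / real N) N x * h x \<partial>lborel_power N)"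
    by (simp only: mult.left_commute[of "laguerre_weight _ _ _ _"] integral_mult_right_zero)
  finally have "E h = 0"
    using N0 by (simp add: integral_laguerre_ensemble[OF hp])
  also have "E h = A * E (\<lambda>x. p r x * \<Pi>Y M x) + - 1 * E (\<lambda>x. p (r + 1) x * \<Pi>Y M x)
      + \<alpha> * (\<Sum>s\<le>r. E (\<lambda>x. p s x * p (r - s) x * \<Pi>Y M x))
      + 1 / real N * (\<Sum>b\<in>#M. real b * E (\<lambda>x. p (r + b) x * \<Pi>Y (M - {#b#}) x))"
    (is "_ = ?rhs")
  proof -
    have "E h = E (\<lambda>x. A * (p r x * \<Pi>Y M x)) + E (\<lambda>x. - 1 * (p (r + 1) x * \<Pi>Y M x))
      + E (\<lambda>x. \<alpha> * (\<Sum>s\<le>r. p s x * p (r - s) x * \<Pi>Y M x))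
      + E (\<lambda>x. 1 / real N * (\<Sum>b\<in>#M. real b * (p (r + b) x * \<Pi>Y (M - {#b#}) x)))"
      unfolding h_def[abs_def]
      by (subst Bochner_Integration.integral_add, (intro integrable pb)+)+ (rule refl)
    also have "E (\<lambda>x. \<alpha> * (\<Sum>s\<le>r. p s x * p (r - s) x * \<Pi>Y M x))
        = \<alpha> * (\<Sum>s\<le>r. E (\<lambda>x. p s x * p (r - s) x * \<Pi>Y M x))"
      by (subst integral_mult_right_zero, subst Bochner_Integration.integral_sum)
        (intro integrable pb refl)+
    also have "E (\<lambda>x. 1 / real N * (\<Sum>b\<in>#M. real b * (p (r + b) x * \<Pi>Y (M - {#b#}) x)))
        = 1 / real N * (\<Sum>b\<in>#M. real b * E (\<lambda>x. p (r + b) x * \<Pi>Y (M - {#b#}) x))"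
      by (subst integral_mult_right_zero, subst E_sum_mset, intro pb, simp only: integral_mult_right_zero)
    finally show ?thesis by (simp only: integral_mult_right_zero)
  qed
  finally show ?thesis by (simp add: A_def)
qed

text \<open>The loop equation with test factors \<open>M\<close>, minus \<kappa> M times the one
  without test factors. The subtraction removes the products of two means and leaves the correction
  by \<kappa> of the pair s, r - s. Every centered moment on the right has total degree at most r
  plus the degree of \<open>M\<close>, one less than on the left.\<close>

lemma moment_recursion:
  "\<kappa> (add_mset (r + 1) M)
    = (real r + 1 + \<alpha>\<^sub>1 - \<alpha> * (real r + 1) / real N) * \<kappa> (add_mset r M)
      + \<alpha> * (\<Sum>s\<le>r. m s * \<kappa> (add_mset (r - s) M) + m (r - s) * \<kappa> (add_mset s M)
            + \<kappa> (add_mset s (add_mset (r - s) M)) - \<kappa> {#s, r - s#} * \<kappa> M)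
      + 1 / real N * (\<Sum>b\<in>#M. real b * (\<kappa> (add_mset (r + b) (M - {#b#})) + m (r + b) * \<kappa> (M - {#b#})))"
proof -
  define A where "A = real r + 1 + \<alpha>\<^sub>1 - \<alpha> * (real r + 1) / real N"
  have 1: "\<kappa> (add_mset (r + 1) M) + m (r + 1) * \<kappa> M = A * (\<kappa> (add_mset r M) + m r * \<kappa> M)
      + \<alpha> * (\<Sum>s\<le>r. \<kappa> (add_mset s (add_mset (r - s) M)) + m s * \<kappa> (add_mset (r - s) M)
            + m (r - s) * \<kappa> (add_mset s M) + m s * m (r - s) * \<kappa> M)
      + 1 / real N * (\<Sum>b\<in>#M. real b * (\<kappa> (add_mset (r + b) (M - {#b#})) + m (r + b) * \<kappa> (M - {#b#})))"
    using loop_equation[of r M] unfolding E_mult E_mult2 A_def .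
  \<comment> \<open>Without test factors the single centered moments vanish, so the next mean is
    given by means and covariances only.\<close>
  have 2: "m (r + 1) = A * m r + \<alpha> * (\<Sum>s\<le>r. \<kappa> {#s, r - s#} + m s * m (r - s))"
    using loop_equation[of r "{#}"] unfolding E_mult E_mult2 A_def
    by (simp only: moment_single moment_empty image_mset_empty sum_mset.empty mult_zero_right
        mult_1_right add_0_left add_0_right)
  have 3: "(\<Sum>s\<le>r. \<kappa> (add_mset s (add_mset (r - s) M)) + m s * \<kappa> (add_mset (r - s) M)
            + m (r - s) * \<kappa> (add_mset s M) + m s * m (r - s) * \<kappa> M)
      = (\<Sum>s\<le>r. m s * \<kappa> (add_mset (r - s) M) + m (r - s) * \<kappa> (add_mset s M)
            + \<kappa> (add_mset s (add_mset (r - s) M)) - \<kappa> {#s, r - s#} * \<kappa> M)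
        + (\<Sum>s\<le>r. \<kappa> {#s, r - s#} + m s * m (r - s)) * \<kappa> M"
    unfolding sum_distrib_right sum.distrib[symmetric] by (intro sum.cong refl) (simp add: algebra_simps)
  show ?thesis using 1 unfolding 2 3 A_def[symmetric] by (simp add: algebra_simps)
qed

end

section \<open>Orders in \<open>1/N\<close> and the limit\<close>

lemma bigo_one_mult:
  fixes f g h :: "nat \<Rightarrow> real"
  assumes "f \<in> O(\<lambda>_. 1)" "g \<in> O(h)"
  shows "(\<lambda>N. f N * g N) \<in> O(h)"
  using landau_o.big.mult[OF assms] by simp

lemma bigo_sum_mset:
  fixes f :: "'a \<Rightarrow> nat \<Rightarrow> real"
  assumes "\<And>b. b \<in># M \<Longrightarrow> f b \<in> O(h)"
  shows "(\<lambda>N. \<Sum>b\<in>#M. f b N) \<in> O(h)"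
  using assms by (induction M) (auto intro: sum_in_bigo)

lemma convergent_bigo_one:
  fixes f :: "nat \<Rightarrow> real"
  assumes "f \<longlonglongrightarrow> c"
  shows "f \<in> O(\<lambda>_. 1)"
  using assms by (intro bigoI_tendsto[of f _ c]) auto

lemma loop_coefficient_tendsto:
  "(\<lambda>N. real r + 1 + \<alpha>\<^sub>1 - \<alpha> * (real r + 1) / real N) \<longlonglongrightarrow> real r + 1 + \<alpha>\<^sub>1"
  using tendsto_diff[OF tendsto_const lim_const_over_n[of "\<alpha> * (real r + 1)"]] by simp

text \<open>The recursion lowers the total degree by one, so induction on the total degree closes the
  hierarchy although it couples a moment to moments of more factors.\<close>

lemma centered_moment_bigo:
  fixes M :: "nat multiset"
  assumes nondeg: "\<forall>\<^sub>F N in sequentially. laguerre_nondegenerate \<alpha>\<^sub>1 \<alpha> N"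
    and mean: "\<And>a. (\<lambda>N. mean_stat \<alpha>\<^sub>1 \<alpha> N a) \<in> O(\<lambda>_. 1)"
    and cov: "\<And>a b. 1 \<le> a \<Longrightarrow> 1 \<le> b \<Longrightarrow>
      (\<lambda>N. centered_moment \<alpha>\<^sub>1 \<alpha> N {#a, b#}) \<in> O(\<lambda>N. 1 / real N)"
    and "3 \<le> size M"
  shows "(\<lambda>N. centered_moment \<alpha>\<^sub>1 \<alpha> N M) \<in> O(\<lambda>N. 1 / real N ^ 2)"
  using \<open>3 \<le> size M\<close>
proof (induction "sum_mset M" arbitrary: M rule: less_induct)
  case (less M0)
  let ?k = "\<lambda>N. centered_moment \<alpha>\<^sub>1 \<alpha> N" and ?m = "mean_stat \<alpha>\<^sub>1 \<alpha>"
  have zero: "(\<lambda>N. ?k N M) \<in> O(h)" if "\<forall>\<^sub>F N in sequentially. ?k N M = 0" for M and h :: "nat \<Rightarrow> real"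
    using landau_o.big.in_cong[OF that, of h] by simp
  have has_0: "(\<lambda>N. ?k N M) \<in> O(h)" if "0 \<in># M" for M and h :: "nat \<Rightarrow> real"
    by (rule zero, rule eventually_mono[OF nondeg]) (rule laguerre_nondegenerate.moment_0[OF _ that])
  have sq: "(\<lambda>N. 1 / real N ^ 2) \<in> O(\<lambda>N. 1 / real N)"
    by (rule bigoI[of _ 1], rule eventually_mono[OF eventually_gt_at_top[of 0]])
      (simp add: field_simps power2_eq_square)
  \<comment> \<open>One rate covers every nonempty multiset of smaller degree: single moments
    vanish, pairs are covered by \<open>cov\<close> or contain 0, and larger multisets obey the
    stronger induction hypothesis.\<close>
  have low: "(\<lambda>N. ?k N M) \<in> O(\<lambda>N. 1 / real N)" if M: "1 \<le> size M" "sum_mset M < sum_mset M0" for M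
  proof -
    consider "size M = 1" | "size M = 2" | "3 \<le> size M" using M(1) by linarith
    then show ?thesis
    proof cases
      case 1
      then obtain a where a: "M = {#a#}" by (metis size_1_singleton_mset)
      show ?thesis
        unfolding a by (rule zero, rule eventually_mono[OF nondeg]) (rule laguerre_nondegenerate.moment_single)
    next
      case 2
      then obtain a M' where M': "M = add_mset a M'" by (cases M) auto
      with 2 have "size M' = 1" by simp
      then obtain b where "M' = {#b#}" by (metis size_1_singleton_mset)
      with M' have ab: "M = {#a, b#}" by simp
      show ?thesis
      proof (cases "0 \<in># M")
        case False
        then show ?thesis unfolding ab by (intro cov) auto
      qed (rule has_0)
    next
      case 3
      then show ?thesis using less.hyps[OF M(2)] sq landau_o.big_trans by blast
    qed
  qed
  show ?case
  proof (cases "0 \<in># M0")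
    case False
    obtain c M where M0: "M0 = add_mset c M" using less.prems by (cases M0) auto
    obtain r where r: "c = r + 1" using False M0 by (cases c) auto
    have size: "2 \<le> size M" using less.prems M0 by simp
    have sumM: "sum_mset M0 = r + 1 + sum_mset M" by (simp add: M0 r)
    have *: "\<forall>\<^sub>F N in sequentially. ?k N M0 =
        (real r + 1 + \<alpha>\<^sub>1 - \<alpha> * (real r + 1) / real N) * ?k N (add_mset r M)
      + \<alpha> * (\<Sum>s\<le>r. ?m N s * ?k N (add_mset (r - s) M) + ?m N (r - s) * ?k N (add_mset s M)
            + ?k N (add_mset s (add_mset (r - s) M)) - ?k N {#s, r - s#} * ?k N M)
      + 1 / real N * (\<Sum>b\<in>#M. real b * (?k N (add_mset (r + b) (M - {#b#})) + ?m N (r + b) * ?k N (M - {#b#})))"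
      using nondeg unfolding M0 r by eventually_elim (rule laguerre_nondegenerate.moment_recursion)
    have 1: "(\<lambda>N. (real r + 1 + \<alpha>\<^sub>1 - \<alpha> * (real r + 1) / real N) * ?k N (add_mset r M)) \<in> O(\<lambda>N. 1 / real N ^ 2)"
      using size sumM
      by (intro bigo_one_mult convergent_bigo_one[OF loop_coefficient_tendsto] less.hyps) auto
    \<comment> \<open>Here \<open>M\<close> may have just two factors, so its moment is only O(1/N);
      the missing order comes from the covariance of the pair.\<close>
    have prod: "(\<lambda>N. ?k N {#s, r - s#} * ?k N M) \<in> O(\<lambda>N. 1 / real N ^ 2)" if "s \<le> r" for s
    proof -
      have "(\<lambda>N. ?k N {#s, r - s#} * ?k N M) \<in> O(\<lambda>N. 1 / real N * (1 / real N))"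
        using size sumM that by (intro landau_o.big.mult low) auto
      then show ?thesis by (simp add: power2_eq_square)
    qed
    have 2: "(\<lambda>N. \<Sum>s\<le>r. ?m N s * ?k N (add_mset (r - s) M) + ?m N (r - s) * ?k N (add_mset s M)
            + ?k N (add_mset s (add_mset (r - s) M)) - ?k N {#s, r - s#} * ?k N M) \<in> O(\<lambda>N. 1 / real N ^ 2)"
      using size sumM
      by (intro big_sum_in_bigo sum_in_bigo bigo_one_mult mean less.hyps prod) auto
    \<comment> \<open>Order 1/N is enough because the sum is multiplied by 1/N. The bound needs
      \<open>M - {#b#}\<close> to be nonempty, which holds since \<open>M\<close> has at least two
      elements.\<close>
    have 3: "(\<lambda>N. \<Sum>b\<in>#M. real b * (?k N (add_mset (r + b) (M - {#b#})) + ?m N (r + b) * ?k N (M - {#b#})))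
        \<in> O(\<lambda>N. 1 / real N)"
    proof (intro bigo_sum_mset)
      fix b assume b: "b \<in># M"
      obtain M' where M': "M = add_mset b M'" using multi_member_split[OF b] by blast
      then have s: "sum_mset M = b + sum_mset (M - {#b#})" "size M = Suc (size (M - {#b#}))"
        by simp_all
      have "(\<lambda>N. ?k N (add_mset (r + b) (M - {#b#})) + ?m N (r + b) * ?k N (M - {#b#})) \<in> O(\<lambda>N. 1 / real N)"
        using s size sumM by (intro sum_in_bigo bigo_one_mult mean low) auto
      then show "(\<lambda>N. real b * (?k N (add_mset (r + b) (M - {#b#})) + ?m N (r + b) * ?k N (M - {#b#})))
          \<in> O(\<lambda>N. 1 / real N)"
        by (intro bigo_one_mult) auto
    qed
    have "(\<lambda>N. 1 / real N * (\<Sum>b\<in>#M. real b * (?k N (add_mset (r + b) (M - {#b#})) + ?m N (r + b) * ?k N (M - {#b#}))))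
        \<in> O(\<lambda>N. 1 / real N * (1 / real N))"
      by (intro landau_o.big.mult 3) simp
    then have 4: "(\<lambda>N. 1 / real N * (\<Sum>b\<in>#M. real b * (?k N (add_mset (r + b) (M - {#b#})) + ?m N (r + b) * ?k N (M - {#b#}))))
        \<in> O(\<lambda>N. 1 / real N ^ 2)"
      by (simp add: power2_eq_square)
    show ?thesis
      unfolding landau_o.big.in_cong[OF *]
      by (intro sum_in_bigo(1) 1 4 bigo_one_mult[OF _ 2]) simp
  qed (rule has_0)
qed

section \<open>Scaled covariances and the limiting recursion\<close>

lemma covariance_power_stat:
  assumes "0 < N"
  shows "1 / real N * covariance (high_temp_ensemble \<alpha>\<^sub>1 \<alpha> N) (power_stat N a) (power_stat N b)
    = real N * centered_moment \<alpha>\<^sub>1 \<alpha> N {#a, b#}"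
proof -
  have "power_stat N a x - (\<integral>y. power_stat N a y \<partial>high_temp_ensemble \<alpha>\<^sub>1 \<alpha> N)
      = real N * centered_stat \<alpha>\<^sub>1 \<alpha> N a x" for a x
    using assms by (simp add: centered_stat_def mean_stat_def right_diff_distrib)
  then show ?thesis
    using assms by (simp add: covariance_def centered_moment_def mult_ac)
qed

lemma degenerate_ensemble:
  assumes "laguerre_partition_function \<alpha>\<^sub>1 \<beta> N = 0"
  shows "(\<integral>x. power_stat N a x \<partial>laguerre_ensemble \<alpha>\<^sub>1 \<beta> N) = 0"
    and "covariance (laguerre_ensemble \<alpha>\<^sub>1 \<beta> N) (power_stat N a) (power_stat N b) = 0"
proof -
  have 0: "(\<integral>x. f x \<partial>laguerre_ensemble \<alpha>\<^sub>1 \<beta> N) = 0" if "poly_bounded N f" for f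
    using integral_laguerre_ensemble[OF that] assms by simp
  show "(\<integral>x. power_stat N a x \<partial>laguerre_ensemble \<alpha>\<^sub>1 \<beta> N) = 0"
    by (intro 0 poly_bounded_intros)
  show "covariance (laguerre_ensemble \<alpha>\<^sub>1 \<beta> N) (power_stat N a) (power_stat N b) = 0"
    unfolding covariance_def by (intro 0 poly_bounded_intros)
qed

text \<open>Zeros at infinitely many indices force the limit to be 0; this is how null measures
  along a subsequence are handled.\<close>

lemma limit_eq_0:
  fixes X :: "nat \<Rightarrow> real"
  assumes "X \<longlonglongrightarrow> L" "\<exists>\<^sub>F N in sequentially. P N" "\<And>N. P N \<Longrightarrow> X N = 0"
  shows "L = 0"
proof (rule ccontr)
  assume "L \<noteq> 0"
  then have "\<forall>\<^sub>F N in sequentially. X N \<noteq> 0" by (rule tendsto_imp_eventually_ne[OF assms(1)])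
  then have "\<forall>\<^sub>F N in sequentially. \<not> P N" by eventually_elim (use assms(3) in blast)
  with assms(2) show False by (simp add: frequently_def)
qed

theorem mainTheorem5:
  fixes \<alpha>\<^sub>1 \<alpha> :: real
    and W :: "nat \<Rightarrow> nat \<Rightarrow> complex list \<Rightarrow> complex"
    and m :: "nat \<Rightarrow> real"
    and \<mu> :: "nat \<Rightarrow> nat \<Rightarrow> real"
  assumes "\<alpha>\<^sub>1 > - 1" and "\<alpha> > - 1"
    and "large_N_ansatz \<alpha>\<^sub>1 \<alpha> W"
    and "expansion_at_infinity1 (\<lambda>x. W 1 0 [x]) m"
    and "expansion_at_infinity2 (\<lambda>x y. W 2 0 [x, y]) \<mu>"
    and "\<And>p. (\<lambda>N. (1 / real N) *
               (\<integral>x. linear_statistic N (\<lambda>t. t ^ p) x \<partial>high_temp_ensemble \<alpha>\<^sub>1 \<alpha> N))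
           \<longlonglongrightarrow> m p"
    and "\<And>p q. p \<ge> 1 \<Longrightarrow> q \<ge> 1 \<Longrightarrow>
           (\<lambda>N. (1 / real N) *
               covariance (high_temp_ensemble \<alpha>\<^sub>1 \<alpha> N)
                 (linear_statistic N (\<lambda>t. t ^ p)) (linear_statistic N (\<lambda>t. t ^ q)))
           \<longlonglongrightarrow> \<mu> p q"
    and "\<And>q. q \<ge> 1 \<Longrightarrow> \<mu> 0 q = 0"
  shows "\<forall>p q. q \<ge> 1 \<longrightarrow>
     \<mu> (p + 1) q =
       (real p + 1 + \<alpha>\<^sub>1) * \<mu> p q + real q * m (p + q)
         + 2 * \<alpha> * (\<Sum>s<p. m s * \<mu> (p - s) q)
   \<and> \<mu> (p + 1) q =
       (real p + 1 + \<alpha>\<^sub>1 + 2 * \<alpha>) * \<mu> p q + real q * m (p + q)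
         + 2 * \<alpha> * (\<Sum>s=1..<p. m s * \<mu> (p - s) q)"
proof (cases "\<forall>\<^sub>F N in sequentially. laguerre_partition_function \<alpha>\<^sub>1 (2 * \<alpha> / real N) N \<noteq> 0")
  case False
  then have freq: "\<exists>\<^sub>F N in sequentially. laguerre_partition_function \<alpha>\<^sub>1 (2 * \<alpha> / real N) N = 0"
    by (simp add: frequently_def)
  \<comment> \<open>If the partition function vanishes for infinitely many N, all limits are 0,
    including \<open>m 0\<close>, and both recursions reduce to 0 = 0.\<close>
  have m0: "m a = 0" for a
    by (rule limit_eq_0[OF assms(6) freq]) (simp add: degenerate_ensemble)
  have "\<mu> a b = 0" if "1 \<le> a" "1 \<le> b" for a b
    by (rule limit_eq_0[OF assms(7)[OF that] freq]) (simp add: degenerate_ensemble)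
  then have \<mu>0: "\<mu> a b = 0" if "1 \<le> b" for a b
    using that assms(8) by (cases "a = 0") auto
  show ?thesis by (simp add: m0 \<mu>0)
next
  case True
  let ?k = "\<lambda>N. centered_moment \<alpha>\<^sub>1 \<alpha> N" and ?m = "mean_stat \<alpha>\<^sub>1 \<alpha>"
  have nondeg: "\<forall>\<^sub>F N in sequentially. laguerre_nondegenerate \<alpha>\<^sub>1 \<alpha> N"
    using True eventually_gt_at_top[of 0] by eventually_elim (rule laguerre_nondegenerate.intro)
  have mean: "(\<lambda>N. ?m N a) \<longlonglongrightarrow> m a" for a
    using assms(6)[of a] by (simp add: mean_stat_def)
  \<comment> \<open>Exponent 0 is included because the recursion produces it at the ends of the sum;
    there the convention \<mu> 0 q = 0 matches the vanishing centered moment.\<close>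
  have cov: "(\<lambda>N. real N * ?k N {#a, b#}) \<longlonglongrightarrow> \<mu> a b" if b: "1 \<le> b" for a b
  proof (cases "a = 0")
    case True
    have "\<forall>\<^sub>F N in sequentially. real N * ?k N {#a, b#} = 0"
      using nondeg by eventually_elim (simp add: True laguerre_nondegenerate.moment_0)
    then show ?thesis using assms(8)[OF b] True by (simp add: tendsto_eventually)
  next
    case False
    have "\<forall>\<^sub>F N in sequentially. 1 / real N * covariance (high_temp_ensemble \<alpha>\<^sub>1 \<alpha> N) (power_stat N a) (power_stat N b)
        = real N * ?k N {#a, b#}"
      using eventually_gt_at_top[of 0] by eventually_elim (rule covariance_power_stat)
    from Lim_transform_eventually[OF assms(7) this] show ?thesis using False b by simp
  qed
  have cov_bigo: "(\<lambda>N. ?k N {#a, b#}) \<in> O(\<lambda>N. 1 / real N)" if "1 \<le> b" for a b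
  proof -
    have "(\<lambda>N. (real N * ?k N {#a, b#}) * (1 / real N)) \<in> O(\<lambda>N. 1 / real N)"
      by (intro bigo_one_mult convergent_bigo_one[OF cov[OF that]]) simp
    moreover have "\<forall>\<^sub>F N in sequentially. (real N * ?k N {#a, b#}) * (1 / real N) = ?k N {#a, b#}"
      using eventually_gt_at_top[of 0] by eventually_elim simp
    ultimately show ?thesis by (simp add: landau_o.big.in_cong)
  qed
  \<comment> \<open>This is where the hierarchy decouples: covariances are multiplied by N to have a
    limit, and third moments of order 1/N^2 do not survive that scaling.\<close>
  have third: "(\<lambda>N. real N * ?k N M) \<longlonglongrightarrow> 0" if "3 \<le> size M" for M
  proof -
    have "(\<lambda>N. ?k N M) \<in> O(\<lambda>N. 1 / real N ^ 2)"
      using nondeg convergent_bigo_one[OF mean] cov_bigo that by (rule centered_moment_bigo)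
    then have "(\<lambda>N. real N * ?k N M) \<in> O(\<lambda>N. real N * (1 / real N ^ 2))"
      by (rule landau_o.big.mult_left)
    also have "(\<lambda>N. real N * (1 / real N ^ 2)) = (\<lambda>N. 1 / real N)"
      by (rule ext) (simp add: power2_eq_square)
    also have "(\<lambda>N. 1 / real N) \<in> o(\<lambda>_. 1)"
      using lim_const_over_n[of 1] by (intro smalloI_tendsto) auto
    finally show ?thesis using smalloD_tendsto by fastforce
  qed
  have rec: "\<mu> (p + 1) q = (real p + 1 + \<alpha>\<^sub>1) * \<mu> p q
      + \<alpha> * (\<Sum>s\<le>p. m s * \<mu> (p - s) q + m (p - s) * \<mu> s q) + real q * m (p + q)"
    if q: "1 \<le> q" for p q
  proof -
    have "(\<lambda>N. (real p + 1 + \<alpha>\<^sub>1 - \<alpha> * (real p + 1) / real N) * (real N * ?k N {#p, q#})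
        + \<alpha> * (\<Sum>s\<le>p. ?m N s * (real N * ?k N {#p - s, q#}) + ?m N (p - s) * (real N * ?k N {#s, q#})
            + real N * ?k N {#s, p - s, q#}) + real q * ?m N (p + q))
      \<longlonglongrightarrow> (real p + 1 + \<alpha>\<^sub>1) * \<mu> p q
        + \<alpha> * (\<Sum>s\<le>p. m s * \<mu> (p - s) q + m (p - s) * \<mu> s q + 0) + real q * m (p + q)"
      by (intro tendsto_intros loop_coefficient_tendsto mean cov[OF q] third) simp
    moreover have "\<forall>\<^sub>F N in sequentially.
        (real p + 1 + \<alpha>\<^sub>1 - \<alpha> * (real p + 1) / real N) * (real N * ?k N {#p, q#})
        + \<alpha> * (\<Sum>s\<le>p. ?m N s * (real N * ?k N {#p - s, q#}) + ?m N (p - s) * (real N * ?k N {#s, q#})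
            + real N * ?k N {#s, p - s, q#}) + real q * ?m N (p + q)
        = real N * ?k N {#p + 1, q#}"
      using nondeg
    proof eventually_elim
      case (elim N)
      then interpret laguerre_nondegenerate \<alpha>\<^sub>1 \<alpha> N .
      have "?k N {#p + 1, q#} = (real p + 1 + \<alpha>\<^sub>1 - \<alpha> * (real p + 1) / real N) * ?k N {#p, q#}
        + \<alpha> * (\<Sum>s\<le>p. ?m N s * ?k N {#p - s, q#} + ?m N (p - s) * ?k N {#s, q#} + ?k N {#s, p - s, q#})
        + real q * ?m N (p + q) / real N"
        \<comment> \<open>With one test factor, \<kappa> {#q#} = 0 kills the nonlinear correction,
          and \<kappa> {#} = 1 leaves only the mean of exponent p + q in the last sum.\<close>
        using moment_recursion[of p "{#q#}"] by (simp add: moment_single moment_empty)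
      moreover have "real N * (A * K + \<alpha> * S + Q / real N) = A * (real N * K) + \<alpha> * (real N * S) + Q" for A K S Q
        using N by (simp add: field_simps)
      ultimately show ?case by (simp add: sum_distrib_left distrib_left mult.left_commute)
    qed
    ultimately have "(\<lambda>N. real N * ?k N {#p + 1, q#}) \<longlonglongrightarrow> (real p + 1 + \<alpha>\<^sub>1) * \<mu> p q
        + \<alpha> * (\<Sum>s\<le>p. m s * \<mu> (p - s) q + m (p - s) * \<mu> s q + 0) + real q * m (p + q)"
      by (rule Lim_transform_eventually)
    from LIMSEQ_unique[OF cov[OF q] this] show ?thesis by simp
  qed
  have m0: "m 0 = 1"
  proof -
    have "\<forall>\<^sub>F N in sequentially. ?m N 0 = 1"
      using nondeg by eventually_elim (rule laguerre_nondegenerate.mean_0)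
    then have "(\<lambda>N. ?m N 0) \<longlonglongrightarrow> 1" by (rule tendsto_eventually)
    with mean show ?thesis by (rule LIMSEQ_unique)
  qed
  have "\<mu> (p + 1) q = (real p + 1 + \<alpha>\<^sub>1) * \<mu> p q + real q * m (p + q)
         + 2 * \<alpha> * (\<Sum>s<p. m s * \<mu> (p - s) q)
   \<and> \<mu> (p + 1) q = (real p + 1 + \<alpha>\<^sub>1 + 2 * \<alpha>) * \<mu> p q + real q * m (p + q)
         + 2 * \<alpha> * (\<Sum>s=1..<p. m s * \<mu> (p - s) q)" if q: "1 \<le> q" for p q
  proof -
    let ?S = "\<Sum>s<p. m s * \<mu> (p - s) q"
    \<comment> \<open>The term s = p carries \<mu> 0 q = 0, which is why the range shrinks to s <
      p.\<close>
    have "(\<Sum>s\<le>p. m s * \<mu> (p - s) q) = ?S"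
      using assms(8)[OF q] by (simp add: lessThan_Suc_atMost[symmetric])
    moreover have "(\<Sum>s\<le>p. m (p - s) * \<mu> s q) = (\<Sum>s\<le>p. m s * \<mu> (p - s) q)"
      by (rule sum.reindex_bij_witness[of _ "\<lambda>i. p - i" "\<lambda>i. p - i"]) auto
    ultimately have first: "\<mu> (p + 1) q = (real p + 1 + \<alpha>\<^sub>1) * \<mu> p q + real q * m (p + q) + 2 * \<alpha> * ?S"
      using rec[OF q, of p] by (simp add: sum.distrib)
    \<comment> \<open>The term s = 0 is split off with m 0 = 1, so its contribution moves into the
      coefficient of \<mu> p q. For p = 0 there is no such term, and the equality holds since \<mu>
      0 q = 0.\<close>
    have "?S = \<mu> p q + (\<Sum>s=1..<p. m s * \<mu> (p - s) q)"
    proof (cases "p = 0")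
      case False
      then show ?thesis
        by (simp add: lessThan_atLeast0 sum.atLeast_Suc_lessThan[of 0 p] m0)
    qed (simp add: assms(8)[OF q])
    then show ?thesis using first by (simp add: distrib_left distrib_right)
  qed
  then show ?thesis by blast
qed

end
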